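(* Let $B$ be a finite connected left regular band (possibly without identity), $\Bbbk$ a commutative ring with unit, and $X\in\Lambda(B)$. Then the augmented simplicial chain complex $C_\bullet(\Delta(B_{\ge X});\Bbbk)\xrightarrow{\ \varepsilon\ }\Bbbk_X$ is a projective resolution of $\Bbbk_X$ by $\Bbbk B$-modules.
   Context: A left regular band is a finite semigroup $B$ with $x^2=x$ and $xyx=xy$ for all $x,y$. The $\mathcal R$-order is $a\le b$ iff $ba=a$. $\Lambda(B)=\{Ba:a\in B\}$ (where $Ba=\{ba:b\in B\}$) ordered by inclusion, $\sigma(a)=Ba$. For $X\in\Lambda(B)$, $B_{\ge X}=\{z\in B:\sigma(z)\ge X\}$ with the $\mathcal R$-order, and $\Delta(B_{\ge X})$ is its order complex. $B$ is connected if every $\Delta(B_{\ge X})$ is connected. $\Bbbk_X$ is $\Bbbk$ with $b$ acting as $1$ if $\sigma(b)\ge X$ and $0$ otherwise. The chain groups are $\Bbbk B$-modules via left multiplication: $b$ sends a chain $z_0<\cdots<z_q$ in $B_{\ge X}$ to $bz_0<\cdots<bz_q$ when $\sigma(b)\ge X$ and this is again a chain of $q+1$ distinct elements, and to $0$ otherwise; $\varepsilon$ sends each vertex to $1$. *)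

theory Defs
  imports "HOL-Analysis.Analysis" "HOL-Library.Poly_Mapping"
begin

section \<open>Left regular bands\<close>

class left_regular_band = finite + semigroup_mult +
  assumes band_idem: "x * x = x"
    and left_regular: "x * y * x = x * y"

definition R_le :: "'b::left_regular_band \<Rightarrow> 'b \<Rightarrow> bool"
  where "R_le a b \<longleftrightarrow> b * a = a"

definition R_less :: "'b::left_regular_band \<Rightarrow> 'b \<Rightarrow> bool"
  where "R_less a b \<longleftrightarrow> R_le a b \<and> a \<noteq> b"

definition sigma :: "'b::left_regular_band \<Rightarrow> 'b set"
  where "sigma a = {b * a |b. True}"

definition support_lattice :: "'b::left_regular_band set set"
  where "support_lattice = range sigma"

definition B_ge :: "'b::left_regular_band set \<Rightarrow> 'b set"
  where "B_ge X = {z. X \<subseteq> sigma z}"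


section \<open>Order complexes\<close>

definition order_complex :: "('a \<Rightarrow> 'a \<Rightarrow> bool) \<Rightarrow> 'a set \<Rightarrow> 'a set set"
  where "order_complex le P =
    {s. finite s \<and> s \<noteq> {} \<and> s \<subseteq> P \<and> (\<forall>x\<in>s. \<forall>y\<in>s. le x y \<or> le y x)}"

text \<open>
  Geometric realization by barycentric coordinates. The product topology on functions is the
  correct one here because it is only used for finite complexes.
\<close>

definition geometric_realization :: "'a set set \<Rightarrow> ('a \<Rightarrow> real) set"
  where "geometric_realization K =
    {t. (\<forall>v. 0 \<le> t v) \<and> {v. t v \<noteq> 0} \<in> K \<and> (\<Sum>v\<in>{v. t v \<noteq> 0}. t v) = 1}"

definition connected_lrb :: "'b::left_regular_band itself \<Rightarrow> bool"
  where "connected_lrb _ \<longleftrightarrow>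
    (\<forall>X\<in>(support_lattice :: 'b set set).
       connected (geometric_realization (order_complex R_le (B_ge X))))"


section \<open>The semigroup algebra of a finite semigroup\<close>

text \<open>
  The semigroup need not have an identity, so a priori this is only a ring without unit.
\<close>

typedef ('b, 'k) semigroup_algebra = "UNIV :: ('b::finite \<Rightarrow> 'k) set"
  morphisms coeff Abs_semigroup_algebra
  by simp

setup_lifting type_definition_semigroup_algebra

lemma semigroup_algebra_eqI: "(\<And>b. coeff x b = coeff y b) \<Longrightarrow> x = y"
  by (metis coeff_inject ext)

instantiation semigroup_algebra :: (finite, ab_group_add) ab_group_add
begin

lift_definition zero_semigroup_algebra :: "('a, 'b) semigroup_algebra" is "\<lambda>_. 0" .

lift_definition plus_semigroup_algebra ::
  "('a, 'b) semigroup_algebra \<Rightarrow> ('a, 'b) semigroup_algebra \<Rightarrow> ('a, 'b) semigroup_algebra"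
  is "\<lambda>x y b. x b + y b" .

lift_definition uminus_semigroup_algebra ::
  "('a, 'b) semigroup_algebra \<Rightarrow> ('a, 'b) semigroup_algebra"
  is "\<lambda>x b. - x b" .

lift_definition minus_semigroup_algebra ::
  "('a, 'b) semigroup_algebra \<Rightarrow> ('a, 'b) semigroup_algebra \<Rightarrow> ('a, 'b) semigroup_algebra"
  is "\<lambda>x y b. x b - y b" .

instance
  by standard (transfer; simp add: fun_eq_iff algebra_simps)+

end

instantiation semigroup_algebra :: ("{finite, semigroup_mult}", comm_ring) ring
begin

lift_definition times_semigroup_algebra ::
  "('a, 'b) semigroup_algebra \<Rightarrow> ('a, 'b) semigroup_algebra \<Rightarrow> ('a, 'b) semigroup_algebra"
  is "\<lambda>x y c. \<Sum>a\<in>UNIV. \<Sum>b\<in>UNIV. if a * b = c then x a * y b else 0" .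

instance
proof
  fix x y z :: "('a, 'b) semigroup_algebra"
  have L: "coeff (x * y * z) d =
      (\<Sum>a\<in>UNIV. \<Sum>b\<in>UNIV. \<Sum>c\<in>UNIV.
         if a * b * c = d then coeff x a * coeff y b * coeff z c else 0)" (is "_ = ?T") for d
  proof -
    have "coeff (x * y * z) d =
      (\<Sum>e\<in>UNIV. \<Sum>c\<in>UNIV. \<Sum>a\<in>UNIV. \<Sum>b\<in>UNIV.
         if a * b = e \<and> e * c = d then coeff x a * coeff y b * coeff z c else 0)"
      by (simp add: times_semigroup_algebra.rep_eq sum_distrib_right if_distrib
          cong: if_cong sum.cong)
         (intro sum.cong refl, auto simp: sum_distrib_right intro!: sum.cong)
    also have "\<dots> = (\<Sum>c\<in>UNIV. \<Sum>a\<in>UNIV. \<Sum>b\<in>UNIV. \<Sum>e\<in>UNIV.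
         if a * b = e \<and> e * c = d then coeff x a * coeff y b * coeff z c else 0)"
      by (rule trans[OF sum.swap], rule sum.cong[OF refl], rule trans[OF sum.swap], rule sum.cong[OF refl], rule trans[OF sum.swap], rule refl)
    also have "\<dots> = (\<Sum>c\<in>UNIV. \<Sum>a\<in>UNIV. \<Sum>b\<in>UNIV. \<Sum>e\<in>UNIV.
         if e = a * b then (if a * b * c = d then coeff x a * coeff y b * coeff z c else 0) else 0)"
      by (intro sum.cong refl) auto
    also have "\<dots> = (\<Sum>c\<in>UNIV. \<Sum>a\<in>UNIV. \<Sum>b\<in>UNIV.
         if a * b * c = d then coeff x a * coeff y b * coeff z c else 0)"
      by simp
    also have "\<dots> = ?T"
      by (rule trans[OF sum.swap], rule sum.cong[OF refl], rule trans[OF sum.swap], rule refl)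
    finally show ?thesis .
  qed
  have R: "coeff (x * (y * z)) d =
      (\<Sum>a\<in>UNIV. \<Sum>b\<in>UNIV. \<Sum>c\<in>UNIV.
         if a * b * c = d then coeff x a * coeff y b * coeff z c else 0)" (is "_ = ?T") for d
  proof -
    have "coeff (x * (y * z)) d =
      (\<Sum>a\<in>UNIV. \<Sum>e\<in>UNIV. \<Sum>b\<in>UNIV. \<Sum>c\<in>UNIV.
         if b * c = e \<and> a * e = d then coeff x a * coeff y b * coeff z c else 0)"
      by (simp add: times_semigroup_algebra.rep_eq sum_distrib_left if_distrib
          cong: if_cong sum.cong)
         (intro sum.cong refl, auto simp: sum_distrib_left mult.assoc intro!: sum.cong)
    also have "\<dots> = (\<Sum>a\<in>UNIV. \<Sum>b\<in>UNIV. \<Sum>c\<in>UNIV. \<Sum>e\<in>UNIV.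
         if b * c = e \<and> a * e = d then coeff x a * coeff y b * coeff z c else 0)"
      by (rule sum.cong[OF refl], rule trans[OF sum.swap], rule sum.cong[OF refl], rule trans[OF sum.swap], rule refl)
    also have "\<dots> = (\<Sum>a\<in>UNIV. \<Sum>b\<in>UNIV. \<Sum>c\<in>UNIV. \<Sum>e\<in>UNIV.
         if e = b * c then (if a * b * c = d then coeff x a * coeff y b * coeff z c else 0) else 0)"
      by (intro sum.cong refl) (auto simp: mult.assoc)
    also have "\<dots> = ?T"
      by simp
    finally show ?thesis .
  qed
  show "x * y * z = x * (y * z)"
    by (rule semigroup_algebra_eqI) (simp only: L R)
  show "(x + y) * z = x * z + y * z"
    by (rule semigroup_algebra_eqI)
       (auto simp: times_semigroup_algebra.rep_eq plus_semigroup_algebra.rep_eq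
          sum.distrib[symmetric] distrib_right intro!: sum.cong)
  show "x * (y + z) = x * y + x * z"
    by (rule semigroup_algebra_eqI)
       (auto simp: times_semigroup_algebra.rep_eq plus_semigroup_algebra.rep_eq
          sum.distrib[symmetric] distrib_left intro!: sum.cong)
qed

end


section \<open>Modules, projectivity and projective resolutions\<close>

definition ring_identity :: "'r::ring \<Rightarrow> bool"
  where "ring_identity e \<longleftrightarrow> (\<forall>x. e * x = x \<and> x * e = x)"

text \<open>
  Unital left modules over a unital ring. The class \<open>ring\<close> does not provide a unit, so its
  existence (it is unique) is part of the definition.
\<close>

locale left_module =
  fixes M :: "'m::ab_group_add set" and act :: "'r::ring \<Rightarrow> 'm \<Rightarrow> 'm"
  assumes zero_closed: "0 \<in> M"
    and add_closed: "x \<in> M \<Longrightarrow> y \<in> M \<Longrightarrow> x + y \<in> M"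
    and uminus_closed: "x \<in> M \<Longrightarrow> - x \<in> M"
    and act_closed: "x \<in> M \<Longrightarrow> act r x \<in> M"
    and act_add_right: "x \<in> M \<Longrightarrow> y \<in> M \<Longrightarrow> act r (x + y) = act r x + act r y"
    and act_add_left: "x \<in> M \<Longrightarrow> act (r + s) x = act r x + act s x"
    and act_mult: "x \<in> M \<Longrightarrow> act (r * s) x = act r (act s x)"
    and act_identity: "\<exists>e. ring_identity e \<and> (\<forall>x\<in>M. act e x = x)"

definition module_homs ::
  "'m::ab_group_add set \<Rightarrow> ('r::ring \<Rightarrow> 'm \<Rightarrow> 'm) \<Rightarrow>
   'n::ab_group_add set \<Rightarrow> ('r \<Rightarrow> 'n \<Rightarrow> 'n) \<Rightarrow> ('m \<Rightarrow> 'n) set"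
  where "module_homs M actM N actN =
    {f. f ` M \<subseteq> N \<and> (\<forall>x\<in>M. \<forall>y\<in>M. f (x + y) = f x + f y) \<and>
        (\<forall>r. \<forall>x\<in>M. f (actM r x) = actN r (f x))}"

text \<open>
  The lifting property refers to all modules, but a definition can only quantify over modules
  whose carriers lie in given types. A theorem with this conclusion for type variables
  \<open>'m\<close>, \<open>'n\<close> therefore states the full lifting property.
\<close>

definition projective_module ::
  "'m::ab_group_add itself \<Rightarrow> 'n::ab_group_add itself \<Rightarrow>
   'p::ab_group_add set \<Rightarrow> ('r::ring \<Rightarrow> 'p \<Rightarrow> 'p) \<Rightarrow> bool"
  where "projective_module _ _ P actP \<longleftrightarrow>
    left_module P actP \<and>
    (\<forall>(M :: 'm set) actM (N :: 'n set) actN g f.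
       left_module M actM \<and> left_module N actN \<and>
       g \<in> module_homs M actM N actN \<and> g ` M = N \<and> f \<in> module_homs P actP N actN \<longrightarrow>
       (\<exists>h \<in> module_homs P actP M actM. \<forall>x\<in>P. g (h x) = f x))"

definition projective_resolution ::
  "'m::ab_group_add itself \<Rightarrow> 'n::ab_group_add itself \<Rightarrow>
   (nat \<Rightarrow> 'p::ab_group_add set) \<Rightarrow> (nat \<Rightarrow> 'r::ring \<Rightarrow> 'p \<Rightarrow> 'p) \<Rightarrow> (nat \<Rightarrow> 'p \<Rightarrow> 'p) \<Rightarrow>
   ('p \<Rightarrow> 'q) \<Rightarrow> 'q::ab_group_add set \<Rightarrow> ('r \<Rightarrow> 'q \<Rightarrow> 'q) \<Rightarrow> bool"
  where "projective_resolution _ _ P actP d eps M actM \<longleftrightarrow>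
    left_module M actM \<and>
    (\<forall>q. projective_module TYPE('m) TYPE('n) (P q) (actP q)) \<and>
    (\<forall>q. d (Suc q) \<in> module_homs (P (Suc q)) (actP (Suc q)) (P q) (actP q)) \<and>
    eps \<in> module_homs (P 0) (actP 0) M actM \<and>
    eps ` P 0 = M \<and>
    {x \<in> P 0. eps x = 0} = d 1 ` P 1 \<and>
    (\<forall>q. {x \<in> P (Suc q). d (Suc q) x = 0} = d (Suc (Suc q)) ` P (Suc (Suc q)))"


section \<open>Simplicial chains of the order complex\<close>

text \<open>The simplex with vertices \<open>z\<^sub>0 < \<dots> < z\<^sub>q\<close> is encoded as the list \<open>[z\<^sub>0, \<dots>, z\<^sub>q]\<close>.\<close>

definition ordered_simplices :: "'b::left_regular_band set \<Rightarrow> 'b list set"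
  where "ordered_simplices X =
    {zs. sorted_wrt R_less zs \<and> set zs \<in> order_complex R_le (B_ge X)}"

text \<open>
  The sort \<open>{comm_ring, comm_monoid_mult}\<close> is that of commutative rings with unit; unlike
  \<open>comm_ring_1\<close> it does not exclude the zero ring.
\<close>

definition chain_group ::
  "'b::left_regular_band set \<Rightarrow> nat \<Rightarrow> ('b list \<Rightarrow>\<^sub>0 'k::{comm_ring, comm_monoid_mult}) set"
  where "chain_group X q =
    {c. Poly_Mapping.keys c \<subseteq> {zs \<in> ordered_simplices X. length zs = q + 1}}"

definition chain_act ::
  "'b::left_regular_band set \<Rightarrow> ('b, 'k) semigroup_algebra \<Rightarrow>
   ('b list \<Rightarrow>\<^sub>0 'k::{comm_ring, comm_monoid_mult}) \<Rightarrow> ('b list \<Rightarrow>\<^sub>0 'k)"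
  where "chain_act X r c =
    (\<Sum>b\<in>UNIV. \<Sum>zs\<in>Poly_Mapping.keys c.
       if X \<subseteq> sigma b \<and> map ((*) b) zs \<in> ordered_simplices X
       then Poly_Mapping.single (map ((*) b) zs) (coeff r b * Poly_Mapping.lookup c zs)
       else 0)"

definition boundary ::
  "('b list \<Rightarrow>\<^sub>0 'k::{comm_ring, comm_monoid_mult}) \<Rightarrow> ('b list \<Rightarrow>\<^sub>0 'k)"
  where "boundary c =
    (\<Sum>zs\<in>Poly_Mapping.keys c. \<Sum>i<length zs.
       Poly_Mapping.single (take i zs @ drop (Suc i) zs)
         ((- 1) ^ i * Poly_Mapping.lookup c zs))"

definition augmentation ::
  "('b list \<Rightarrow>\<^sub>0 'k::{comm_ring, comm_monoid_mult}) \<Rightarrow> 'k"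
  where "augmentation c = (\<Sum>zs\<in>Poly_Mapping.keys c. Poly_Mapping.lookup c zs)"

text \<open>The action on the module \<open>k\<^sub>X\<close>, whose carrier is all of the coefficient ring.\<close>

definition simple_act ::
  "'b::left_regular_band set \<Rightarrow> ('b, 'k) semigroup_algebra \<Rightarrow>
   'k::{comm_ring, comm_monoid_mult} \<Rightarrow> 'k"
  where "simple_act X r x = (\<Sum>b\<in>UNIV. if X \<subseteq> sigma b then coeff r b * x else 0)"

end

theory Submission
  imports Defs
begin

text \<open>
  Choosing a representative \<open>f\<^sub>W\<close> of each support \<open>W\<close> and setting
  \<open>e\<^sub>W = f\<^sub>W (1 - \<Sum>V\<subset>W. e\<^sub>V)\<close> gives elements with \<open>b e\<^sub>W = 0\<close> unless \<open>W \<subseteq> sigma b\<close>, whose sum \<open>e\<close>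
  is always a right identity of the semigroup algebra. Since \<open>1 - e\<close> projects every module onto the
  part annihilated by the algebra, connectedness of all \<open>B_ge X\<close> shows by downward induction on \<open>X\<close>
  that \<open>e\<close> acts as the identity on vertices, hence on all chains; so \<open>e\<close> is a two-sided identity.
  Exactness follows because each \<open>b\<close> maps the complex into a cone, and projectivity from an explicit
  lift built from the \<open>e\<^sub>W\<close> and \<open>f\<^sub>W\<close>.
\<close>


section \<open>Supports\<close>

lemma mem_sigma_self: "a \<in> sigma a"
  unfolding sigma_def using band_idem[of a] by (metis (mono_tags, lifting) mem_Collect_eq)

lemma mem_sigma_iff: "a \<in> sigma b \<longleftrightarrow> a * b = a"
  unfolding sigma_def by (auto simp: mult.assoc band_idem) metis

lemma sigma_le_iff: "sigma a \<subseteq> sigma b \<longleftrightarrow> a * b = a"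
proof
  assume "sigma a \<subseteq> sigma b"
  then show "a * b = a"
    using mem_sigma_self[of a] by (auto simp: mem_sigma_iff)
next
  assume "a * b = a"
  then show "sigma a \<subseteq> sigma b"
    by (auto simp: mem_sigma_iff) (metis mult.assoc)
qed

text \<open>Left regularity gives \<open>a * b * a = a * b\<close>, so the product also lies below
  its first factor. Supports therefore form a meet semilattice and \<open>sigma\<close> is
  multiplicative.\<close>

lemma sigma_mult: "sigma (a * b) = sigma a \<inter> sigma b"
proof -
  have "sigma (a * b) \<subseteq> sigma a"
    by (simp add: sigma_le_iff left_regular)
  moreover have "sigma (a * b) \<subseteq> sigma b"
    by (simp add: sigma_le_iff mult.assoc band_idem)
  moreover have "sigma a \<inter> sigma b \<subseteq> sigma (a * b)"
    by (auto simp: mem_sigma_iff) (metis mult.assoc)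
  ultimately show ?thesis by blast
qed

lemma sigma_in_support_lattice [simp]: "sigma a \<in> support_lattice"
  by (simp add: support_lattice_def)

section \<open>The R-order and left multiplication\<close>

lemma R_le_refl: "R_le a a"
  by (simp add: R_le_def band_idem)

lemma R_le_antisym: "R_le a b \<Longrightarrow> R_le b a \<Longrightarrow> a = b"
  unfolding R_le_def by (metis left_regular)

lemma R_le_trans: "R_le a b \<Longrightarrow> R_le b c \<Longrightarrow> R_le a c"
  unfolding R_le_def by (metis mult.assoc)

text \<open>In \<open>c * b * (c * a)\<close> the second \<open>c\<close> is absorbed by
  \<open>c * b * c = c * b\<close>. Hence left multiplication sends chains to weakly increasing
  sequences.\<close>

lemma R_le_mult_left: "R_le a b \<Longrightarrow> R_le (c * a) (c * b)"
  unfolding R_le_def by (metis mult.assoc left_regular)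

lemma transp_R_less: "transp R_less"
  unfolding transp_def R_less_def by (metis R_le_antisym R_le_trans)

lemma R_le_imp_sigma_le: "R_le a b \<Longrightarrow> sigma a \<subseteq> sigma b"
  unfolding R_le_def sigma_le_iff by (metis left_regular)

text \<open>With equal supports \<open>b * a\<close> would be both \<open>a\<close> and
  \<open>b\<close>. Inductions on support along a chain rest on this strictness.\<close>

lemma R_less_imp_sigma_less: "R_less a b \<Longrightarrow> sigma a \<subset> sigma b"
  unfolding R_less_def by (metis R_le_def R_le_imp_sigma_le psubsetI sigma_le_iff subset_refl)


section \<open>Monomials in the semigroup algebra\<close>

lift_definition monomial :: "'b::finite \<Rightarrow> 'k::zero \<Rightarrow> ('b, 'k) semigroup_algebra"
  is "\<lambda>b k c. if c = b then k else 0" .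

lemma monomial_zero [simp]: "monomial b 0 = (0 :: ('b::finite, 'k::ab_group_add) semigroup_algebra)"
  by transfer auto

lemma monomial_add:
  "monomial b (k + l) = monomial b k + (monomial b l :: ('b::finite, 'k::ab_group_add) semigroup_algebra)"
  by transfer auto

lemma monomial_mult:
  "monomial a k * monomial b l =
    (monomial (a * b) (k * l) :: ('b::{finite,semigroup_mult}, 'k::comm_ring) semigroup_algebra)"
proof (rule semigroup_algebra_eqI)
  fix c
  have "coeff (monomial a k * monomial b l) c =
      (\<Sum>x\<in>UNIV. \<Sum>y\<in>UNIV. if x = a then (if y = b then (if a * b = c then k * l else 0) else 0) else 0)"
    unfolding times_semigroup_algebra.rep_eq monomial.rep_eq by (intro sum.cong refl) auto
  also have "\<dots> = (\<Sum>x\<in>UNIV. if x = a then (if a * b = c then k * l else 0) else 0)"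
    by (intro sum.cong refl) simp
  also have "\<dots> = coeff (monomial (a * b) (k * l)) c"
    by (simp add: monomial.rep_eq)
  finally show "coeff (monomial a k * monomial b l) c = coeff (monomial (a * b) (k * l)) c" .
qed

lemma coeff_zero [simp]: "coeff 0 b = 0"
  by (simp add: zero_semigroup_algebra.rep_eq)

lemma coeff_add [simp]: "coeff (x + y) b = coeff x b + coeff y b"
  by (simp add: plus_semigroup_algebra.rep_eq)

lemma coeff_monomial [simp]: "coeff (monomial a k) b = (if b = a then k else 0)"
  by (simp add: monomial.rep_eq)

lemma coeff_sum: "coeff (sum f A) b = (\<Sum>i\<in>A. coeff (f i) b)"
  by (induction A rule: infinite_finite_induct) auto

lemma sum_monomials: "(\<Sum>b\<in>UNIV. monomial b (coeff r b)) = (r :: ('b::finite, 'k::ab_group_add) semigroup_algebra)"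
  by (rule semigroup_algebra_eqI) (simp add: coeff_sum)

lemma monomial_induct [case_names zero monomial add]:
  fixes r :: "('b::finite, 'k::ab_group_add) semigroup_algebra"
  assumes "P 0" and "\<And>b k. P (monomial b k)" and "\<And>x y. P x \<Longrightarrow> P y \<Longrightarrow> P (x + y)"
  shows "P r"
proof -
  have "P (\<Sum>b\<in>A. monomial b (coeff r b))" for A
    by (induction A rule: infinite_finite_induct) (auto intro: assms)
  from this[of UNIV] show ?thesis by (simp add: sum_monomials)
qed

text \<open>The law \<open>x * y * x = x * y\<close> is linear in the middle factor
  \<open>y\<close>, so that factor may be any element of the algebra.\<close>

lemma monomial_left_regular:
  fixes r :: "('b::left_regular_band, 'k::{comm_ring, comm_monoid_mult}) semigroup_algebra"
  shows "monomial b 1 * r * monomial b 1 = monomial b 1 * r"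
proof (induction r rule: monomial_induct)
  case (monomial a k)
  then show ?case by (simp add: monomial_mult left_regular)
qed (simp_all add: algebra_simps)


section \<open>A right identity\<close>

definition support_rep :: "'b::left_regular_band set \<Rightarrow> 'b"
  where "support_rep W = (SOME z. sigma z = W)"

lemma sigma_support_rep: "W \<in> support_lattice \<Longrightarrow> sigma (support_rep W) = W"
  unfolding support_rep_def support_lattice_def by (rule someI_ex) auto

text \<open>The product \<open>f\<^sub>W (1 - \<Sum>V\<subset>W. e\<^sub>V)\<close> is multiplied
  out because no unit of the algebra is available yet.\<close>

function support_idem ::
    "'b::left_regular_band set \<Rightarrow> ('b, 'k::{comm_ring, comm_monoid_mult}) semigroup_algebra"
  where "support_idem W = monomial (support_rep W) 1
    - monomial (support_rep W) 1 * (\<Sum>V\<in>{V \<in> support_lattice. V \<subset> W}. support_idem V)"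
  by auto
termination
  by (relation "Wellfounded.measure card") (auto intro!: psubset_card_mono)

declare support_idem.simps [simp del]

text \<open>Both terms of the recursion start with the idempotent \<open>f\<^sub>W\<close>, and
  \<open>f\<^sub>W r f\<^sub>W = f\<^sub>W r\<close> absorbs the factor on the right.\<close>

lemma support_idem_rep: "support_idem W * monomial (support_rep W) 1 = support_idem W"
  by (subst (1 2) support_idem.simps)
    (simp add: left_diff_distrib monomial_mult band_idem monomial_left_regular)

text \<open>For \<open>W = sigma z\<close> one has \<open>z f\<^sub>W = z\<close>, so the top term
  is \<open>z - z (\<Sum>V\<subset>W. e\<^sub>V)\<close> and cancels all the others.\<close>

lemma sum_mult_support_idem_le:
  "(\<Sum>V\<in>{V \<in> support_lattice. V \<subseteq> sigma z}. monomial z k * support_idem V) = monomial z k"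
proof -
  define W where "W = sigma z"
  have W: "W \<in> support_lattice" by (simp add: W_def)
  have zf: "z * support_rep W = z"
    using sigma_support_rep[OF W] unfolding W_def by (simp flip: sigma_le_iff)
  let ?S = "\<lambda>W. {V \<in> support_lattice. V \<subset> W}"
  have *: "monomial z k * support_idem W = monomial z k - monomial z k * sum support_idem (?S W)"
    by (subst support_idem.simps)
      (simp add: right_diff_distrib monomial_mult zf flip: mult.assoc)
  have "{V \<in> support_lattice. V \<subseteq> W} = insert W (?S W)" using W by auto
  then have "(\<Sum>V\<in>{V \<in> support_lattice. V \<subseteq> W}. monomial z k * support_idem V) =
      monomial z k * support_idem W + (\<Sum>V\<in>?S W. monomial z k * support_idem V)"
    by simp
  also have "\<dots> = monomial z k"
    by (simp add: * sum_distrib_left)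
  finally show ?thesis by (simp add: W_def)
qed

text \<open>Put \<open>y = z f\<^sub>W\<close>, whose support is properly below \<open>W\<close>.
  Then \<open>z e\<^sub>W = y - y (\<Sum>V\<subset>W. e\<^sub>V)\<close>. By induction only the
  \<open>V\<close> below \<open>sigma y\<close> contribute to the sum, and by the previous lemma
  they add up to \<open>y\<close>.\<close>

lemma mult_support_idem_eq_0:
  assumes "W \<in> support_lattice" and "\<not> W \<subseteq> sigma z"
  shows "monomial z k * support_idem W = 0"
  using assms
proof (induction "card W" arbitrary: W z k rule: less_induct)
  case less
  define y where "y = z * support_rep W"
  have sy: "sigma y = sigma z \<inter> W"
    using less.prems by (simp add: y_def sigma_mult sigma_support_rep)
  have "(\<Sum>V\<in>{V \<in> support_lattice. V \<subset> W}. monomial y k * support_idem V)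
      = (\<Sum>V\<in>{V \<in> support_lattice. V \<subseteq> sigma y}. monomial y k * support_idem V)"
  proof (rule sum.mono_neutral_right)
    show "{V \<in> support_lattice. V \<subseteq> sigma y} \<subseteq> {V \<in> support_lattice. V \<subset> W}"
      using sy less.prems by auto
    show "\<forall>V\<in>{V \<in> support_lattice. V \<subset> W} - {V \<in> support_lattice. V \<subseteq> sigma y}.
        monomial y k * support_idem V = 0"
      by (auto intro!: less.hyps psubset_card_mono)
  qed simp
  also have "\<dots> = monomial y k" by (rule sum_mult_support_idem_le)
  finally show ?case
    by (subst support_idem.simps)
      (simp add: right_diff_distrib monomial_mult sum_distrib_left y_def flip: mult.assoc)
qed

definition band_unit :: "('b::left_regular_band, 'k::{comm_ring, comm_monoid_mult}) semigroup_algebra"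
  where "band_unit = (\<Sum>W\<in>support_lattice. support_idem W)"

lemma mult_band_unit: "r * band_unit = r"
proof (induction r rule: monomial_induct)
  case (monomial z k)
  have "monomial z k * band_unit = (\<Sum>V\<in>support_lattice. monomial z k * support_idem V)"
    by (simp add: band_unit_def sum_distrib_left)
  also have "\<dots> = (\<Sum>V\<in>{V \<in> support_lattice. V \<subseteq> sigma z}. monomial z k * support_idem V)"
    by (rule sum.mono_neutral_right) (auto intro!: mult_support_idem_eq_0)
  finally show ?case by (simp add: sum_mult_support_idem_le)
qed (simp_all add: distrib_right)

text \<open>Compare the coefficients of \<open>a\<close> in \<open>a e = a\<close>: the products
  \<open>a * b\<close> equal to \<open>a\<close> are exactly those with
  \<open>sigma a \<subseteq> sigma b\<close>. This makes the right identity act as 1 on the simple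
  module.\<close>

lemma sum_coeff_band_unit:
  fixes a :: "'b::left_regular_band"
  shows "(\<Sum>b\<in>{b. sigma a \<subseteq> sigma b}. coeff band_unit b) = (1 :: 'k::{comm_ring, comm_monoid_mult})"
proof -
  have "coeff (monomial a 1 * band_unit) a =
      (\<Sum>x\<in>UNIV. if x = a then (\<Sum>b\<in>UNIV. if sigma a \<subseteq> sigma b then coeff band_unit b else 0) else (0::'k))"
    unfolding times_semigroup_algebra.rep_eq coeff_monomial
    by (intro sum.cong refl) (auto simp: sigma_le_iff intro!: sum.cong sum.neutral)
  then show ?thesis
    by (simp add: mult_band_unit sum.If_cases)
qed


section \<open>Additive extensions to finitely supported functions\<close>

text \<open>The coefficient is an argument of \<open>F\<close> because the target carries no scalar
  multiplication; in the projectivity proof it is only an abelian group.\<close>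

definition pm_extend :: "('a \<Rightarrow> 'k::zero \<Rightarrow> 'm::comm_monoid_add) \<Rightarrow> ('a \<Rightarrow>\<^sub>0 'k) \<Rightarrow> 'm"
  where "pm_extend F c = (\<Sum>x\<in>Poly_Mapping.keys c. F x (Poly_Mapping.lookup c x))"

lemma pm_extend_zero [simp]: "pm_extend F 0 = 0"
  by (simp add: pm_extend_def)

lemma pm_extend_add:
  assumes "\<And>x. F x 0 = 0" and "\<And>x k l. F x (k + l) = F x k + F x l"
  shows "pm_extend F (c + d) = pm_extend F c + pm_extend F d"
  unfolding pm_extend_def by (rule setsum_keys_plus_distrib) (simp_all add: assms)

lemma pm_extend_single: "F x 0 = 0 \<Longrightarrow> pm_extend F (Poly_Mapping.single x k) = F x k"
  by (simp add: pm_extend_def)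

lemma pm_induct [consumes 1, case_names zero single add]:
  fixes c :: "'a \<Rightarrow>\<^sub>0 'k::comm_monoid_add"
  assumes "Poly_Mapping.keys c \<subseteq> S"
    and "P 0" and "\<And>x k. x \<in> S \<Longrightarrow> P (Poly_Mapping.single x k)"
    and "\<And>c d. Poly_Mapping.keys c \<subseteq> S \<Longrightarrow> Poly_Mapping.keys d \<subseteq> S \<Longrightarrow> P c \<Longrightarrow> P d \<Longrightarrow> P (c + d)"
  shows "P c"
proof -
  let ?sum = "\<lambda>A. \<Sum>x\<in>A. Poly_Mapping.single x (Poly_Mapping.lookup c x)"
  have "Poly_Mapping.keys (?sum A) \<subseteq> S \<and> P (?sum A)" if "finite A" "A \<subseteq> S" for A
    using that
  proof (induction A rule: finite_induct)
    case (insert x A)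
    have "Poly_Mapping.keys (Poly_Mapping.single x (Poly_Mapping.lookup c x)) \<subseteq> S"
      using insert.prems by simp
    with insert show ?case
      using keys_add[of "Poly_Mapping.single x (Poly_Mapping.lookup c x)" "?sum A"]
      by (auto intro!: assms(3,4))
  qed (simp add: assms)
  moreover have "?sum (Poly_Mapping.keys c) = c"
    by (rule poly_mapping_eqI) (simp add: lookup_sum lookup_single when_def in_keys_iff)
  ultimately show ?thesis
    using assms(1) by (metis finite_keys)
qed


section \<open>Simplices and chains\<close>

lemma ordered_simplices_iff:
  "zs \<in> ordered_simplices X \<longleftrightarrow> zs \<noteq> [] \<and> sorted_wrt R_less zs \<and> set zs \<subseteq> B_ge X"
proof -
  have "\<forall>x\<in>set zs. \<forall>y\<in>set zs. R_le x y \<or> R_le y x" if "sorted_wrt R_less zs" for zs :: "'a list"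
    using that by (induction zs) (auto simp: R_less_def R_le_refl)
  then show ?thesis
    by (auto simp: ordered_simplices_def order_complex_def)
qed

lemma sorted_R_less_distinct: "sorted_wrt R_less zs \<Longrightarrow> distinct zs"
  by (induction zs) (auto simp: R_less_def)

lemma sorted_R_less_iff: "sorted_wrt R_less zs \<longleftrightarrow> sorted_wrt R_le zs \<and> distinct zs"
  by (induction zs) (auto simp: R_less_def)

section \<open>Left multiplication and faces of simplices\<close>

lemma mult_mem_B_ge: "X \<subseteq> sigma b \<Longrightarrow> z \<in> B_ge X \<Longrightarrow> b * z \<in> B_ge X"
  by (auto simp: B_ge_def sigma_mult)

lemma sorted_R_le_map: "sorted_wrt R_less zs \<Longrightarrow> sorted_wrt R_le (map ((*) b) zs)"
  unfolding sorted_wrt_map by (erule sorted_wrt_mono_rel[rotated]) (simp add: R_less_def R_le_mult_left)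

text \<open>Left multiplication by \<open>b\<close> preserves the weak order and stays in
  \<open>B_ge X\<close>, so the image can only fail to be a simplex by repeating a vertex.\<close>

lemma map_mem_ordered_simplices_iff:
  assumes "zs \<in> ordered_simplices X" and "X \<subseteq> sigma b"
  shows "map ((*) b) zs \<in> ordered_simplices X \<longleftrightarrow> distinct (map ((*) b) zs)"
proof -
  have "set (map ((*) b) zs) \<subseteq> B_ge X"
    using assms by (auto simp: ordered_simplices_iff intro: mult_mem_B_ge)
  then show ?thesis
    using assms sorted_R_le_map[of zs b] unfolding ordered_simplices_iff sorted_R_less_iff by auto
qed

lemma R_le_last: "zs \<in> ordered_simplices X \<Longrightarrow> z \<in> set zs \<Longrightarrow> R_le z (last zs)"
  unfolding ordered_simplices_iff
  by (cases zs rule: rev_cases) (auto simp: sorted_wrt_append R_less_def R_le_refl)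

text \<open>The last vertex is the R-greatest, and \<open>R_le z y\<close> means
  \<open>y * z = z\<close>.\<close>

lemma map_last_mult: "zs \<in> ordered_simplices X \<Longrightarrow> map ((*) (last zs)) zs = zs"
  by (rule map_idI) (auto dest: R_le_last simp: R_le_def)

lemma nth_mem_face:
  assumes "m < length zs" and "m \<noteq> i"
  shows "zs ! m \<in> set (take i zs @ drop (Suc i) zs)"
proof (cases "m < i")
  case True
  then have "zs ! m = take i zs ! m" "m < length (take i zs)" using assms by auto
  then show ?thesis by (metis UnI1 nth_mem set_append)
next
  case False
  then have "zs ! m = drop (Suc i) zs ! (m - Suc i)" "m - Suc i < length (drop (Suc i) zs)"
    using assms by auto
  then show ?thesis by (metis UnI2 nth_mem set_append)
qed

lemma face_mem_ordered_simplices: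
  assumes "zs \<in> ordered_simplices X" and "i < length zs" and "2 \<le> length zs"
  shows "take i zs @ drop (Suc i) zs \<in> ordered_simplices X"
proof -
  have "zs = take i zs @ zs ! i # drop (Suc i) zs"
    using assms by (simp add: id_take_nth_drop[symmetric])
  then have "sorted_wrt R_less (take i zs @ zs ! i # drop (Suc i) zs)"
    using assms(1) by (metis ordered_simplices_iff)
  moreover have "take i zs @ drop (Suc i) zs \<noteq> []"
    using assms by auto
  moreover have "set (take i zs @ drop (Suc i) zs) \<subseteq> set zs"
    using set_take_subset[of i zs] set_drop_subset[of "Suc i" zs] by auto
  ultimately show ?thesis
    using assms(1) by (auto simp: ordered_simplices_iff sorted_wrt_append)
qed

section \<open>Chain groups\<close>

lemma chain_group_zero [simp]: "0 \<in> chain_group X q"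
  by (simp add: chain_group_def)

lemma chain_group_add: "c \<in> chain_group X q \<Longrightarrow> d \<in> chain_group X q \<Longrightarrow> c + d \<in> chain_group X q"
  using keys_add[of c d] by (auto simp: chain_group_def)

lemma chain_group_uminus: "c \<in> chain_group X q \<Longrightarrow> - c \<in> chain_group X q"
  by (auto simp: chain_group_def keys_def)

lemma chain_group_diff: "c \<in> chain_group X q \<Longrightarrow> d \<in> chain_group X q \<Longrightarrow> c - d \<in> chain_group X q"
  using chain_group_add[of c X q "- d"] chain_group_uminus[of d] by simp

lemma chain_group_sum: "(\<And>i. i \<in> I \<Longrightarrow> f i \<in> chain_group X q) \<Longrightarrow> sum f I \<in> chain_group X q"
  by (induction I rule: infinite_finite_induct) (auto intro: chain_group_add)

lemma chain_group_single:
  "zs \<in> ordered_simplices X \<Longrightarrow> length zs = q + 1 \<Longrightarrow> Poly_Mapping.single zs k \<in> chain_group X q"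
  by (auto simp: chain_group_def)

lemma chain_group_induct [consumes 1, case_names zero single add]:
  assumes "c \<in> chain_group X q"
    and "P 0"
    and "\<And>zs k. zs \<in> ordered_simplices X \<Longrightarrow> length zs = q + 1 \<Longrightarrow> P (Poly_Mapping.single zs k)"
    and "\<And>c d. c \<in> chain_group X q \<Longrightarrow> d \<in> chain_group X q \<Longrightarrow> P c \<Longrightarrow> P d \<Longrightarrow> P (c + d)"
  shows "P c"
proof -
  have "Poly_Mapping.keys c \<subseteq> {zs \<in> ordered_simplices X. length zs = q + 1}"
    using assms(1) by (simp add: chain_group_def)
  then show ?thesis
    by (induction c rule: pm_induct) (use assms in \<open>auto simp: chain_group_def\<close>)
qed

section \<open>The action of the algebra on chains, computed on one simplex and one band
  element\<close>

definition chain_monomial_act ::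
  "'b::left_regular_band set \<Rightarrow> 'b \<Rightarrow> 'k::zero \<Rightarrow> 'b list \<Rightarrow> 'b list \<Rightarrow>\<^sub>0 'k"
  where "chain_monomial_act X b k zs =
    (if X \<subseteq> sigma b \<and> map ((*) b) zs \<in> ordered_simplices X
     then Poly_Mapping.single (map ((*) b) zs) k else 0)"

lemma chain_monomial_act_zero [simp]: "chain_monomial_act X b 0 zs = 0"
  by (simp add: chain_monomial_act_def)

lemma chain_monomial_act_add:
  "chain_monomial_act X b (k + l) zs = chain_monomial_act X b k zs + chain_monomial_act X b l zs"
  by (simp add: chain_monomial_act_def single_add)

lemma chain_act_eq:
  "chain_act X r c =
    (\<Sum>b\<in>UNIV. pm_extend (\<lambda>zs k. chain_monomial_act X b (coeff r b * k) zs) c)"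
  by (simp add: chain_act_def pm_extend_def chain_monomial_act_def)

lemma chain_act_add_right: "chain_act X r (c + d) = chain_act X r c + chain_act X r d"
  by (simp add: chain_act_eq pm_extend_add chain_monomial_act_add distrib_left sum.distrib)

lemma chain_act_add_left: "chain_act X (r + s) c = chain_act X r c + chain_act X s c"
  by (simp add: chain_act_eq pm_extend_def chain_monomial_act_add distrib_right sum.distrib)

lemma chain_act_zero_right [simp]: "chain_act X r 0 = 0"
  by (simp add: chain_act_eq)

lemma chain_act_zero_left [simp]: "chain_act X 0 c = 0"
  by (simp add: chain_act_eq pm_extend_def)

lemma chain_act_diff_right: "chain_act X r (c - d) = chain_act X r c - chain_act X r d"
  using chain_act_add_right[of X r "c - d" d] by (simp add: algebra_simps)

lemma chain_act_sum_right: "chain_act X r (sum f I) = (\<Sum>i\<in>I. chain_act X r (f i))"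
  by (induction I rule: infinite_finite_induct) (auto simp: chain_act_add_right)

lemma chain_act_sum_left: "chain_act X (sum f I) c = (\<Sum>i\<in>I. chain_act X (f i) c)"
  by (induction I rule: infinite_finite_induct) (auto simp: chain_act_add_left)

lemma chain_act_monomial:
  "chain_act X (monomial b k) c = pm_extend (\<lambda>zs l. chain_monomial_act X b (k * l) zs) c"
proof -
  have "chain_act X (monomial b k) c =
      (\<Sum>a\<in>UNIV. if a = b then pm_extend (\<lambda>zs l. chain_monomial_act X b (k * l) zs) c else 0)"
    unfolding chain_act_eq by (intro sum.cong refl) (auto simp: pm_extend_def)
  then show ?thesis by simp
qed

lemma chain_act_single:
  "chain_act X r (Poly_Mapping.single zs l) = (\<Sum>b\<in>UNIV. chain_monomial_act X b (coeff r b * l) zs)"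
  by (simp add: chain_act_eq pm_extend_single)

lemma chain_act_monomial_single:
  "chain_act X (monomial b k) (Poly_Mapping.single zs l) = chain_monomial_act X b (k * l) zs"
  by (simp add: chain_act_monomial pm_extend_single)

lemma chain_act_monomials:
  "chain_act X r c = (\<Sum>b\<in>UNIV. chain_act X (monomial b (coeff r b)) c)"
  by (simp add: sum_monomials flip: chain_act_sum_left)

lemma chain_monomial_act_closed: "length zs = q + 1 \<Longrightarrow> chain_monomial_act X b k zs \<in> chain_group X q"
  by (auto simp: chain_monomial_act_def intro!: chain_group_single)

lemma chain_act_closed:
  assumes "c \<in> chain_group X q" shows "chain_act X r c \<in> chain_group X q"
  using assms
  by (induction c rule: chain_group_induct)
    (auto simp: chain_act_add_right chain_act_single
      intro!: chain_group_add chain_group_sum chain_monomial_act_closed)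

text \<open>Degeneracy is consistent: if the vertices \<open>a * b * z\<close> are distinct then so
  are the \<open>b * z\<close>, so a nonzero result is never lost at the intermediate step.\<close>

lemma chain_act_monomial_mult_single:
  assumes "zs \<in> ordered_simplices X"
  shows "chain_act X (monomial (a * b) (k * l)) (Poly_Mapping.single zs m) =
    chain_act X (monomial a k) (chain_act X (monomial b l) (Poly_Mapping.single zs m))"
proof -
  have *: "map ((*) a) (map ((*) b) zs) = map ((*) (a * b)) zs"
    by (simp add: mult.assoc)
  show ?thesis
  proof (cases "X \<subseteq> sigma (a * b)")
    case True
    then have X: "X \<subseteq> sigma a" "X \<subseteq> sigma b" by (auto simp: sigma_mult)
    have "map ((*) b) zs \<in> ordered_simplices X" if "map ((*) (a * b)) zs \<in> ordered_simplices X"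
      using that map_mem_ordered_simplices_iff[OF assms True] map_mem_ordered_simplices_iff[OF assms X(2)]
      by (metis * distinct_map)
    then show ?thesis
      using True X *
        by (auto simp: chain_act_monomial_single chain_monomial_act_def mult.assoc[of k] simp del: map_map)
  next
    case False
    then show ?thesis
      by (auto simp: chain_act_monomial_single chain_monomial_act_def sigma_mult)
  qed
qed

lemma chain_act_mult:
  assumes "c \<in> chain_group X q"
  shows "chain_act X (r * s) c = chain_act X r (chain_act X s c)"
  using assms
proof (induction c rule: chain_group_induct)
  case (single zs m)
  show ?case
  proof (induction r rule: monomial_induct)
    case (monomial a k)
    show ?case
      by (induction s rule: monomial_induct)
        (simp_all add: monomial_mult chain_act_monomial_mult_single[OF single(1)] distrib_left
          chain_act_add_left chain_act_add_right)
  qed (simp_all add: distrib_right chain_act_add_left)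
qed (simp_all add: chain_act_add_right)


section \<open>Boundary and augmentation\<close>

definition face_sum :: "'a list \<Rightarrow> 'k::{comm_ring, comm_monoid_mult} \<Rightarrow> 'a list \<Rightarrow>\<^sub>0 'k"
  where "face_sum zs k = (\<Sum>i<length zs. Poly_Mapping.single (take i zs @ drop (Suc i) zs) ((- 1) ^ i * k))"

lemma face_sum_zero [simp]: "face_sum zs 0 = 0"
  by (simp add: face_sum_def)

lemma face_sum_add: "face_sum zs (k + l) = face_sum zs k + face_sum zs l"
  by (simp add: face_sum_def distrib_left single_add sum.distrib)

lemma boundary_eq: "boundary c = pm_extend face_sum c"
  by (simp add: boundary_def pm_extend_def face_sum_def)

lemma boundary_zero [simp]: "boundary 0 = 0"
  by (simp add: boundary_eq)

lemma boundary_add: "boundary (c + d) = boundary c + boundary d"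
  by (simp add: boundary_eq pm_extend_add face_sum_add)

lemma boundary_sum: "boundary (sum f I) = (\<Sum>i\<in>I. boundary (f i))"
  by (induction I rule: infinite_finite_induct) (auto simp: boundary_add)

lemma boundary_single: "boundary (Poly_Mapping.single zs k) = face_sum zs k"
  by (simp add: boundary_eq pm_extend_single)

lemma augmentation_eq: "augmentation c = pm_extend (\<lambda>_ k. k) c"
  by (simp add: augmentation_def pm_extend_def)

lemma augmentation_zero [simp]: "augmentation 0 = 0"
  by (simp add: augmentation_eq)

lemma augmentation_add: "augmentation (c + d) = augmentation c + augmentation d"
  by (simp add: augmentation_eq pm_extend_add)

lemma augmentation_diff: "augmentation (c - d) = augmentation c - augmentation d"
  using augmentation_add[of "c - d" d] by (simp add: algebra_simps)

lemma augmentation_single [simp]: "augmentation (Poly_Mapping.single zs k) = k"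
  by (simp add: augmentation_eq pm_extend_single)

lemma boundary_closed:
  assumes "c \<in> chain_group X (Suc q)" shows "boundary c \<in> chain_group X q"
  using assms
proof (induction c rule: chain_group_induct)
  case (single zs k)
  show ?case
    unfolding boundary_single face_sum_def
    by (intro chain_group_sum chain_group_single face_mem_ordered_simplices) (use single in auto)
qed (auto simp: boundary_add intro: chain_group_add)

text \<open>The only delicate case is a simplex that \<open>b\<close> collapses. Then
  \<open>b\<close> identifies two consecutive vertices \<open>j\<close> and \<open>Suc j\<close>.
  Every face keeping both is collapsed too, and the two faces omitting one of them have equal images
  with opposite signs.\<close>

lemma boundary_chain_act:
  assumes "c \<in> chain_group X (Suc q)"
  shows "boundary (chain_act X r c) = chain_act X r (boundary c)"
  using assms
proof (induction c rule: chain_group_induct)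
  case (single zs l)
  show ?case
  proof (induction r rule: monomial_induct)
    case (monomial b k)
    let ?f = "\<lambda>i. take i zs @ drop (Suc i) zs"
    have R: "chain_act X (monomial b k) (boundary (Poly_Mapping.single zs l)) =
        (\<Sum>i<length zs. chain_monomial_act X b (k * ((- 1) ^ i * l)) (?f i))"
      by (simp add: boundary_single face_sum_def chain_act_sum_right chain_act_monomial_single)
    have f_simplex: "?f i \<in> ordered_simplices X" if "i < length zs" for i
      using face_mem_ordered_simplices[OF single(1)] that single(2) by simp
    have map_f: "map ((*) b) (?f i) = take i (map ((*) b) zs) @ drop (Suc i) (map ((*) b) zs)" for i
      by (simp add: take_map drop_map)
    show ?case
    proof (cases "X \<subseteq> sigma b")
      case False
      then show ?thesis unfolding R chain_act_monomial_single by (simp add: chain_monomial_act_def)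
    next
      case X: True
      show ?thesis
      proof (cases "map ((*) b) zs \<in> ordered_simplices X")
        case True
        have "map ((*) b) (?f i) \<in> ordered_simplices X" if "i < length zs" for i
          unfolding map_f using True that single(2) by (intro face_mem_ordered_simplices) auto
        with X True show ?thesis
          unfolding R chain_act_monomial_single
          by (auto simp: chain_monomial_act_def boundary_single face_sum_def map_f ac_simps
              simp del: map_append intro!: sum.cong)
      next
        case False
        \<comment> \<open>By transitivity strictness already fails at some consecutive pair; as the
          image is weakly increasing, that pair must coincide.\<close>
        then have "\<not> sorted_wrt R_less (map ((*) b) zs)"
          using map_mem_ordered_simplices_iff[OF single(1) X] sorted_R_less_distinct by blast
        then obtain j where j: "Suc j < length zs" "\<not> R_less (b * zs ! j) (b * zs ! Suc j)"
          unfolding sorted_wrt_iff_nth_Suc_transp[OF transp_R_less] by auto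
        have "R_less (zs ! j) (zs ! Suc j)"
          using single(1) j(1)
          unfolding ordered_simplices_iff sorted_wrt_iff_nth_Suc_transp[OF transp_R_less] by auto
        then have eq: "b * zs ! j = b * zs ! Suc j"
          using j(2) R_le_mult_left by (auto simp: R_less_def)
        have zs: "zs = take j zs @ zs ! j # zs ! Suc j # drop (Suc (Suc j)) zs"
          using j(1) by (metis Cons_nth_drop_Suc Suc_lessD append_take_drop_id)
        have degenerate: "chain_monomial_act X b m (?f i) = 0"
          if "i < length zs" "i \<noteq> j" "i \<noteq> Suc j" for i m
        proof -
          have "zs ! j \<in> set (?f i)" "zs ! Suc j \<in> set (?f i)"
            using that j(1) by (intro nth_mem_face; simp)+
          moreover have "zs ! j \<noteq> zs ! Suc j"
            using \<open>R_less (zs ! j) (zs ! Suc j)\<close> by (simp add: R_less_def)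
          ultimately have "\<not> distinct (map ((*) b) (?f i))"
            using eq unfolding distinct_map inj_on_def by blast
          then show ?thesis
            using map_mem_ordered_simplices_iff[OF f_simplex[OF that(1)] X]
            by (simp add: chain_monomial_act_def del: map_append)
        qed
        have "(\<Sum>i<length zs. chain_monomial_act X b (k * ((- 1) ^ i * l)) (?f i)) =
            (\<Sum>i\<in>{j, Suc j}. chain_monomial_act X b (k * ((- 1) ^ i * l)) (?f i))"
          using j(1) by (intro sum.mono_neutral_right) (auto intro!: degenerate)
        also have "\<dots> = 0"
        proof -
          have m: "map ((*) b) (?f j) = map ((*) b) (?f (Suc j))"
            using j(1) eq by (simp add: take_Suc_conv_app_nth Cons_nth_drop_Suc[symmetric])
          have "chain_monomial_act X b m (?f j) = chain_monomial_act X b m (?f (Suc j))" for m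
            unfolding chain_monomial_act_def m ..
          then have "(\<Sum>i\<in>{j, Suc j}. chain_monomial_act X b (k * ((- 1) ^ i * l)) (?f i)) =
              chain_monomial_act X b (k * ((- 1) ^ j * l) + k * ((- 1) ^ Suc j * l)) (?f (Suc j))"
            by (simp only: chain_monomial_act_add) simp
          then show ?thesis by simp
        qed
        finally show ?thesis
          unfolding R using False by (simp add: chain_act_monomial_single chain_monomial_act_def)
      qed
    qed
  qed (simp_all add: boundary_add chain_act_add_left)
qed (simp_all add: boundary_add chain_act_add_right)


section \<open>Cones\<close>

lemma neg_one_power_cancel: "(- 1) ^ n * ((- 1) ^ n * k) = (k :: 'k::{comm_ring, comm_monoid_mult})"
  by (induction n) (simp_all add: ac_simps)

text \<open>The apex goes to the end of the list because it will be the R-greatest vertex of the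
  cone.\<close>

definition snoc_chain :: "'a \<Rightarrow> ('a list \<Rightarrow>\<^sub>0 'k::comm_monoid_add) \<Rightarrow> ('a list \<Rightarrow>\<^sub>0 'k)"
  where "snoc_chain b c = pm_extend (\<lambda>zs. Poly_Mapping.single (zs @ [b])) c"

text \<open>The sign is the one with which the boundary deletes an apex appended to
  \<open>zs\<close>, since that apex has index \<open>length zs\<close>.\<close>

definition sign_chain ::
  "('a list \<Rightarrow>\<^sub>0 'k::{comm_ring, comm_monoid_mult}) \<Rightarrow> ('a list \<Rightarrow>\<^sub>0 'k)"
  where "sign_chain c = pm_extend (\<lambda>zs k. Poly_Mapping.single zs ((- 1) ^ length zs * k)) c"

text \<open>Unlike \<open>snoc_chain\<close>, this respects simplices that already contain the apex,
  where appending it would repeat a vertex.\<close>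

definition cone_chain :: "'a \<Rightarrow> ('a list \<Rightarrow>\<^sub>0 'k::comm_monoid_add) \<Rightarrow> ('a list \<Rightarrow>\<^sub>0 'k)"
  where "cone_chain b c =
    pm_extend (\<lambda>zs k. if b \<in> set zs then 0 else Poly_Mapping.single (zs @ [b]) k) c"

lemma snoc_chain_simps [simp]:
  "snoc_chain b 0 = 0"
  "snoc_chain b (c + d) = snoc_chain b c + snoc_chain b d"
  "snoc_chain b (Poly_Mapping.single zs k) = Poly_Mapping.single (zs @ [b]) k"
  by (simp_all add: snoc_chain_def pm_extend_add pm_extend_single single_add)

lemma sign_chain_simps [simp]:
  "sign_chain 0 = 0"
  "sign_chain (c + d) = sign_chain c + sign_chain d"
  "sign_chain (Poly_Mapping.single zs k) = Poly_Mapping.single zs ((- 1) ^ length zs * k)"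
  by (simp_all add: sign_chain_def pm_extend_add pm_extend_single single_add distrib_left)

lemma cone_chain_simps [simp]:
  "cone_chain b 0 = 0"
  "cone_chain b (c + d) = cone_chain b c + cone_chain b d"
  "cone_chain b (Poly_Mapping.single zs k) = (if b \<in> set zs then 0 else Poly_Mapping.single (zs @ [b]) k)"
  by (simp_all add: cone_chain_def pm_extend_add pm_extend_single single_add)

lemma snoc_chain_sum: "snoc_chain b (sum f I) = (\<Sum>i\<in>I. snoc_chain b (f i))"
  by (induction I rule: infinite_finite_induct) auto

lemma sign_chain_sum: "sign_chain (sum f I) = (\<Sum>i\<in>I. sign_chain (f i))"
  by (induction I rule: infinite_finite_induct) auto

lemma cone_chain_sum: "cone_chain b (sum f I) = (\<Sum>i\<in>I. cone_chain b (f i))"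
  by (induction I rule: infinite_finite_induct) auto

lemma face_sum_snoc:
  "face_sum (zs @ [b]) k =
    snoc_chain b (face_sum zs k) + Poly_Mapping.single zs ((- 1) ^ length zs * k)"
  by (simp add: face_sum_def snoc_chain_sum)

text \<open>Each face has one vertex fewer than \<open>zs\<close>, which costs one sign; the empty
  list has no faces.\<close>

lemma sign_chain_face_sum: "sign_chain (face_sum zs k) = - face_sum zs ((- 1) ^ length zs * k)"
proof (cases zs)
  case (Cons z ws)
  then show ?thesis
    by (simp add: face_sum_def sign_chain_sum ac_simps flip: sum_negf single_uminus)
qed (simp add: face_sum_def)

lemma sign_chain_sign_chain [simp]: "sign_chain (sign_chain c) = c"
  by (induction c rule: pm_induct[OF subset_UNIV]) (auto simp: neg_one_power_cancel)

lemma boundary_sign_chain: "boundary (sign_chain c) = - sign_chain (boundary c)"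
  by (induction c rule: pm_induct[OF subset_UNIV])
    (auto simp: boundary_single boundary_add sign_chain_face_sum)

lemma boundary_snoc_chain: "boundary (snoc_chain b c) = snoc_chain b (boundary c) + sign_chain c"
  by (induction c rule: pm_induct[OF subset_UNIV])
    (auto simp: boundary_single boundary_add face_sum_snoc)

text \<open>Induction on the last vertex \<open>b\<close>: the boundary of \<open>zs @ [b]\<close>
  is the boundary of \<open>zs\<close> joined with \<open>b\<close>, plus a signed
  \<open>zs\<close>. Taking boundaries again, the join leaves only the signed boundary of
  \<open>zs\<close>, which cancels the second contribution.\<close>

lemma boundary_face_sum: "boundary (face_sum zs k) = 0"
proof (induction zs arbitrary: k rule: rev_induct)
  case (snoc b zs)
  then show ?case
    by (simp add: face_sum_snoc boundary_add boundary_snoc_chain boundary_single sign_chain_face_sum)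
qed (simp add: face_sum_def)

lemma boundary_boundary: "boundary (boundary c) = 0"
  by (induction c rule: pm_induct[OF subset_UNIV]) (auto simp: boundary_single boundary_add boundary_face_sum)

lemma cone_snoc_chain [simp]: "cone_chain b (snoc_chain b c) = 0"
  by (induction c rule: pm_induct[OF subset_UNIV]) auto

lemma cone_chain_face_sum:
  assumes "b \<notin> set zs" shows "cone_chain b (face_sum zs k) = snoc_chain b (face_sum zs k)"
proof -
  have "b \<notin> set (take i zs)" "b \<notin> set (drop i zs)" for i
    using assms by (auto dest: in_set_takeD in_set_dropD)
  then show ?thesis
    by (simp add: face_sum_def cone_chain_sum snoc_chain_sum)
qed

text \<open>Up to signs, coning is a contracting homotopy. If \<open>b\<close> is not a vertex of
  \<open>zs\<close>, this is the formula for \<open>snoc_chain\<close>. Otherwise \<open>b\<close>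
  is the last vertex, the cone is 0, and the only face whose cone survives is the one without
  \<open>b\<close>; its cone is \<open>zs\<close> with the sign that cancels
  \<open>sign_chain\<close>.\<close>

lemma boundary_cone_chain:
  assumes "Poly_Mapping.keys c \<subseteq> {zs. sorted_wrt R_less zs \<and> (\<forall>z\<in>set zs. R_le z b)}"
  shows "boundary (cone_chain b c) = cone_chain b (boundary c) + sign_chain c"
  using assms
proof (induction c rule: pm_induct)
  case (single zs k)
  show ?case
  proof (cases "b \<in> set zs")
    case False
    then show ?thesis
      by (simp add: boundary_single face_sum_snoc cone_chain_face_sum)
  next
    case True
    then obtain ws y where zs: "zs = ws @ [y]" by (cases zs rule: rev_cases) auto
    have "y = b"
      using True single unfolding zs
      by (auto simp: sorted_wrt_append R_less_def dest: R_le_antisym)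
    moreover have "b \<notin> set ws"
      using sorted_R_less_distinct[of zs] single \<open>y = b\<close> by (auto simp: zs)
    ultimately show ?thesis
      by (simp add: zs boundary_single face_sum_snoc flip: single_add)
  qed
qed (auto simp: boundary_add)

lemma keys_sign_chain: "Poly_Mapping.keys c \<subseteq> S \<Longrightarrow> Poly_Mapping.keys (sign_chain c) \<subseteq> S"
proof (induction c rule: pm_induct)
  case (add c d)
  then show ?case using keys_add[of "sign_chain c" "sign_chain d"] by auto
qed auto

text \<open>The signs form an involution that anticommutes with the boundary, so coning off the
  signed cycle gives a chain with boundary \<open>c\<close>. For \<open>q = 0\<close> the cycle
  condition includes the empty face and means augmentation 0.\<close>

lemma cone_exact:
  fixes c :: "'b::left_regular_band list \<Rightarrow>\<^sub>0 'k::{comm_ring, comm_monoid_mult}"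
  assumes keys: "Poly_Mapping.keys c \<subseteq>
      {zs \<in> ordered_simplices X. length zs = q + 1 \<and> (\<forall>z\<in>set zs. R_le z b)}" (is "_ \<subseteq> ?S")
    and "X \<subseteq> sigma b" and "boundary c = 0"
  shows "\<exists>d\<in>chain_group X (Suc q). boundary d = c"
proof
  have keys': "Poly_Mapping.keys (sign_chain c) \<subseteq> ?S"
    by (rule keys_sign_chain[OF keys])
  have "boundary (cone_chain b (sign_chain c)) =
      cone_chain b (boundary (sign_chain c)) + sign_chain (sign_chain c)"
    by (rule boundary_cone_chain) (use keys' in \<open>auto simp: ordered_simplices_iff\<close>)
  then show "boundary (cone_chain b (sign_chain c)) = c"
    by (simp add: boundary_sign_chain assms(3))
  have "cone_chain b d \<in> chain_group X (Suc q)" if "Poly_Mapping.keys d \<subseteq> ?S"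
    for d :: "'b list \<Rightarrow>\<^sub>0 'k"
    using that
  proof (induction d rule: pm_induct)
    case (single zs k)
    have "zs @ [b] \<in> ordered_simplices X" if "b \<notin> set zs"
      using that single assms(2)
      by (auto simp: ordered_simplices_iff sorted_wrt_append R_less_def B_ge_def)
    then show ?case
      using single by (auto intro: chain_group_single)
  qed (auto intro: chain_group_add)
  then show "cone_chain b (sign_chain c) \<in> chain_group X (Suc q)"
    using keys' .
qed

text \<open>Since \<open>b * (b * z) = b * z\<close>, the image of \<open>b\<close> lies below
  \<open>b\<close>, that is, in the cone required by \<open>cone_exact\<close>.\<close>

lemma keys_chain_act_monomial:
  assumes "c \<in> chain_group X q"
  shows "Poly_Mapping.keys (chain_act X (monomial b k) c) \<subseteq>
    {zs \<in> ordered_simplices X. length zs = q + 1 \<and> (\<forall>z\<in>set zs. R_le z b)}"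
  using assms
proof (induction c rule: chain_group_induct)
  case (single zs l)
  then show ?case
    by (auto simp: chain_act_monomial_single chain_monomial_act_def R_le_def band_idem
        simp flip: mult.assoc)
next
  case (add c d)
  then show ?case
    using keys_add[of "chain_act X (monomial b k) c" "chain_act X (monomial b k) d"]
    by (auto simp: chain_act_add_right)
qed simp


section \<open>The right identity acts as the identity on chains\<close>

lemma simple_act_add_left: "simple_act X (r + s) x = simple_act X r x + simple_act X s x"
  by (auto simp: simple_act_def distrib_right sum.distrib[symmetric] intro!: sum.cong)

lemma simple_act_add_right: "simple_act X r (x + y) = simple_act X r x + simple_act X r y"
  by (auto simp: simple_act_def distrib_left sum.distrib[symmetric] intro!: sum.cong)

lemma simple_act_zero_left [simp]: "simple_act X 0 x = 0"
  using simple_act_add_left[of X 0 0 x] by simp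

lemma simple_act_zero_right [simp]: "simple_act X r 0 = 0"
  using simple_act_add_right[of X r 0 0] by simp

lemma simple_act_monomial: "simple_act X (monomial b k) x = (if X \<subseteq> sigma b then k * x else 0)"
proof -
  have "simple_act X (monomial b k) x =
      (\<Sum>a\<in>UNIV. if a = b then (if X \<subseteq> sigma b then k * x else 0) else 0)"
    unfolding simple_act_def by (intro sum.cong refl) auto
  then show ?thesis by simp
qed

lemma simple_act_band_unit:
  assumes "X \<in> support_lattice" shows "simple_act X band_unit k = k"
proof -
  obtain a where X: "X = sigma a" using assms by (auto simp: support_lattice_def)
  have "simple_act X band_unit k = (\<Sum>b\<in>{b. sigma a \<subseteq> sigma b}. coeff band_unit b) * k"
    unfolding simple_act_def X by (simp add: sum.If_cases sum_distrib_right)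
  then show ?thesis by (simp add: sum_coeff_band_unit)
qed

lemma simple_act_mult: "simple_act X (r * s) x = simple_act X r (simple_act X s x)"
proof (induction r rule: monomial_induct)
  case (monomial a k)
  show ?case
    by (induction s rule: monomial_induct)
      (auto simp: monomial_mult simple_act_monomial sigma_mult distrib_left mult.assoc
        simple_act_add_left simple_act_add_right)
qed (simp_all add: distrib_right simple_act_add_left)

lemma augmentation_chain_act:
  assumes "c \<in> chain_group X 0"
  shows "augmentation (chain_act X r c) = simple_act X r (augmentation c)"
  using assms
proof (induction c rule: chain_group_induct)
  case (single zs l)
  then obtain z where zs: "zs = [z]" by (auto simp: length_Suc_conv)
  show ?case
  proof (induction r rule: monomial_induct)
    case (monomial b k)
    \<comment> \<open>A single vertex cannot degenerate, so both actions vanish for the same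
      \<open>b\<close>.\<close>
    have "map ((*) b) zs \<in> ordered_simplices X" if "X \<subseteq> sigma b"
      using map_mem_ordered_simplices_iff[OF single(1) that] by (simp add: zs)
    then show ?case
      by (simp add: chain_act_monomial_single chain_monomial_act_def simple_act_monomial)
  qed (simp_all add: chain_act_add_left augmentation_add simple_act_add_left)
qed (simp_all add: chain_act_add_right augmentation_add simple_act_add_right)

text \<open>The only face of a one-vertex list is \<open>[]\<close>, which serves as the simplex of
  degree -1. The augmentation is thus the boundary in degree 0, and it kills boundaries because the
  boundary squares to 0.\<close>

lemma boundary_vertices:
  assumes "c \<in> chain_group X 0" shows "boundary c = Poly_Mapping.single [] (augmentation c)"
  using assms
proof (induction c rule: chain_group_induct)
  case (single zs k)
  then obtain z where "zs = [z]" by (auto simp: length_Suc_conv)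
  then show ?case by (simp add: boundary_single face_sum_def)
qed (simp_all add: boundary_add augmentation_add single_add)

lemma augmentation_boundary:
  assumes "c \<in> chain_group X 1" shows "augmentation (boundary c) = 0"
proof -
  have "Poly_Mapping.single [] (augmentation (boundary c)) = boundary (boundary c)"
    using boundary_vertices[OF boundary_closed, of c X] assms by simp
  then show ?thesis
    by (metis boundary_boundary lookup_single_eq lookup_zero)
qed

text \<open>
  If \<open>e = band_unit\<close> fixes the vertices of minimal support in each \<open>B_ge (sigma (last zs))\<close>, then
  \<open>e \<cdot> zs = zs + w\<close> where the simplices in \<open>w\<close> have smaller top support. Inductively
  \<open>e \<cdot> w = w\<close>, and idempotency of \<open>e\<close> forces \<open>w = 0\<close>.
\<close>

lemma band_unit_fixes_simplex:
  fixes zs :: "'b::left_regular_band list" and k :: "'k::{comm_ring, comm_monoid_mult}"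
  assumes top: "\<And>ys. ys \<in> ordered_simplices X \<Longrightarrow> length ys = q + 1 \<Longrightarrow>
      chain_act (sigma (last ys)) band_unit (Poly_Mapping.single [last ys] 1) =
        Poly_Mapping.single [last ys] (1 :: 'k)"
    and "zs \<in> ordered_simplices X" and "length zs = q + 1"
  shows "chain_act X band_unit (Poly_Mapping.single zs k) = Poly_Mapping.single zs k"
  using assms(2,3)
proof (induction "card (sigma (last zs))" arbitrary: zs k rule: less_induct)
  case less
  define z where "z = last zs"
  \<comment> \<open>These are the \<open>b\<close> with \<open>z * b = z\<close>. As
    \<open>z\<close> undoes \<open>b\<close> on all vertices of \<open>zs\<close>, such
    \<open>b\<close> never collapse \<open>zs\<close>; the remaining \<open>b\<close> strictly lower
    the top support and are collected in \<open>w\<close>.\<close>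
  define A where "A = {b. sigma z \<subseteq> sigma b}"
  let ?e = "band_unit :: ('b, 'k) semigroup_algebra"
  define w where "w = (\<Sum>b\<in>-A. chain_monomial_act X b (coeff ?e b * k) zs)"
  have ne: "zs \<noteq> []" using less.prems by auto
  have z: "X \<subseteq> sigma z"
    using less.prems(1) last_in_set[OF ne] unfolding z_def ordered_simplices_iff B_ge_def by blast
  have fix_below: "z * y = y" if "y \<in> set zs" for y
    using R_le_last[OF less.prems(1) that] by (simp add: z_def R_le_def)
  have act_A: "chain_monomial_act X b m zs = Poly_Mapping.single (map ((*) b) zs) m" if "b \<in> A" for b m
  proof -
    have "z * b = z" using that by (simp add: A_def sigma_le_iff)
    then have "z * (b * y) = y" if "y \<in> set zs" for y
      using fix_below[OF that] by (metis mult.assoc)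
    then have "inj_on ((*) b) (set zs)" by (metis inj_onI)
    then have "distinct (map ((*) b) zs)"
      using less.prems(1) sorted_R_less_distinct by (auto simp: distinct_map ordered_simplices_iff)
    moreover have "X \<subseteq> sigma b" using z that by (auto simp: A_def)
    ultimately show ?thesis
      using map_mem_ordered_simplices_iff[OF less.prems(1)] by (simp add: chain_monomial_act_def)
  qed
  \<comment> \<open>\<open>T\<close> replaces a vertex \<open>[y]\<close> by the list of products of
    \<open>y\<close> with the entries of \<open>zs\<close>. Because \<open>z\<close> fixes these
    entries, \<open>T\<close> turns the identity for \<open>e\<close> acting on \<open>[z]\<close>
    into the one for the part of \<open>e\<close> over \<open>A\<close> acting on
    \<open>zs\<close>.\<close>
  define T where "T = pm_extend (\<lambda>ys l. Poly_Mapping.single (map ((*) (hd ys)) zs) (l * k :: 'k))"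
  have T_add: "T (c + d) = T c + T d" for c d
    by (simp add: T_def pm_extend_add distrib_right single_add)
  have T_single: "T (Poly_Mapping.single ys l) = Poly_Mapping.single (map ((*) (hd ys)) zs) (l * k)" for ys l
    by (simp add: T_def pm_extend_single)
  have T_0: "T 0 = 0" by (simp add: T_def)
  have T_sum: "T (sum f I) = (\<Sum>i\<in>I. T (f i))" for f and I :: "'b set"
    by (induction I rule: infinite_finite_induct) (auto simp: T_0 T_add)
  have vertex: "chain_monomial_act (sigma z) b m [z] = (if b \<in> A then Poly_Mapping.single [b * z] m else 0)" for b m
    by (auto simp: chain_monomial_act_def A_def ordered_simplices_iff B_ge_def sigma_mult)
  have "(\<Sum>b\<in>A. chain_monomial_act X b (coeff ?e b * k) zs) = T (\<Sum>b\<in>UNIV. chain_monomial_act (sigma z) b (coeff ?e b * 1) [z])"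
  proof -
    have m: "map ((*) (b * z)) zs = map ((*) b) zs" for b
      using fix_below by (simp add: mult.assoc)
    have "T (chain_monomial_act (sigma z) b (coeff ?e b * 1) [z]) =
        (if b \<in> A then chain_monomial_act X b (coeff ?e b * k) zs else 0)" for b
      unfolding vertex by (simp add: T_single T_0 act_A m del: map_eq_conv)
    then show ?thesis
      unfolding T_sum by (simp only: sum.If_cases finite) simp
  qed
  also have "\<dots> = T (Poly_Mapping.single [z] 1)"
    using top[OF less.prems] unfolding z_def chain_act_single by simp
  also have "\<dots> = Poly_Mapping.single zs k"
    using map_last_mult[OF less.prems(1)] by (simp add: T_single z_def)
  finally have sum_A: "(\<Sum>b\<in>A. chain_monomial_act X b (coeff ?e b * k) zs) = Poly_Mapping.single zs k" .
  have ezs: "chain_act X ?e (Poly_Mapping.single zs k) = Poly_Mapping.single zs k + w"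
    unfolding w_def Compl_eq_Diff_UNIV chain_act_single
    by (subst sum.subset_diff[of A UNIV]) (simp_all only: sum_A subset_UNIV finite add.commute)
  have "chain_act X ?e (chain_monomial_act X b m zs) = chain_monomial_act X b m zs" if "b \<notin> A" for b m
  proof (cases "X \<subseteq> sigma b \<and> map ((*) b) zs \<in> ordered_simplices X")
    case True
    have "last (map ((*) b) zs) = b * z" using ne by (simp add: last_map z_def)
    then have "sigma (last (map ((*) b) zs)) \<subset> sigma (last zs)"
      using that by (auto simp: sigma_mult A_def z_def)
    then have "card (sigma (last (map ((*) b) zs))) < card (sigma (last zs))"
      by (intro psubset_card_mono) auto
    then show ?thesis
      using less.hyps[of "map ((*) b) zs" m] True less.prems(2) by (simp add: chain_monomial_act_def)
  qed (auto simp: chain_monomial_act_def)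
  then have ew: "chain_act X ?e w = w"
    unfolding w_def chain_act_sum_right by (intro sum.cong) auto
  have "Poly_Mapping.single zs k \<in> chain_group X q"
    using less.prems by (auto intro: chain_group_single)
  from chain_act_mult[OF this, of ?e ?e]
  have "chain_act X ?e (chain_act X ?e (Poly_Mapping.single zs k)) = chain_act X ?e (Poly_Mapping.single zs k)"
    by (simp add: mult_band_unit)
  then have "w = 0"
    unfolding ezs chain_act_add_right ew by simp
  then show ?case using ezs by simp
qed

text \<open>The total barycentric weight on the fibre of \<open>f\<close> over \<open>f a\<close> is
  continuous, and it is 1 at the vertex \<open>a\<close>. On each simplex \<open>f\<close> is
  constant, so the weight is 0 or 1 everywhere. If \<open>f b\<close> differed, the weight would be
  0 at \<open>b\<close> and connectedness would force the value 1/2.\<close>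

lemma connected_order_complex_constant:
  fixes P :: "'a::finite set"
  assumes conn: "connected (geometric_realization (order_complex le P))"
    and refl: "\<And>x. le x x"
    and const: "\<And>x y. x \<in> P \<Longrightarrow> y \<in> P \<Longrightarrow> le x y \<Longrightarrow> f x = f y"
    and ab: "a \<in> P" "b \<in> P"
  shows "f a = f b"
proof (rule ccontr)
  assume neq: "f a \<noteq> f b"
  let ?R = "geometric_realization (order_complex le P)"
  define \<phi> where "\<phi> = (\<lambda>t :: 'a \<Rightarrow> real. \<Sum>v\<in>{v. f v = f a}. t v)"
  have "continuous_on UNIV \<phi>"
    unfolding \<phi>_def by (intro continuous_intros continuous_on_product_coordinates)
  then have conn': "connected (\<phi> ` ?R)"
    using connected_continuous_image[OF continuous_on_subset conn] by blast
  define \<delta> where "\<delta> = (\<lambda>p v :: 'a. if v = p then 1 else 0 :: real)"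
  have supp_\<delta>: "{v. \<delta> p v \<noteq> 0} = {p}" for p by (auto simp: \<delta>_def)
  have "\<delta> p \<in> ?R" if "p \<in> P" for p
    using that unfolding geometric_realization_def mem_Collect_eq supp_\<delta>
    by (auto simp: \<delta>_def order_complex_def refl)
  moreover have "\<phi> (\<delta> a) = 1" "\<phi> (\<delta> b) = 0"
    using neq by (auto simp: \<phi>_def \<delta>_def)
  ultimately have "1 \<in> \<phi> ` ?R" "0 \<in> \<phi> ` ?R"
    using ab imageI[of "\<delta> a" ?R \<phi>] imageI[of "\<delta> b" ?R \<phi>] by simp_all
  then have "{0..1} \<subseteq> \<phi> ` ?R"
    by (intro connected_contains_Icc[OF conn'])
  then have "1/2 \<in> \<phi> ` ?R" by (rule subsetD) simp
  then obtain t where t: "t \<in> ?R" and half: "\<phi> t = 1/2" by auto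
  let ?S = "{v. t v \<noteq> 0}"
  have S: "?S \<subseteq> P" "\<forall>x\<in>?S. \<forall>y\<in>?S. le x y \<or> le y x" and sum1: "sum t ?S = 1"
    using t by (auto simp: geometric_realization_def order_complex_def)
  have same: "f v = f w" if "v \<in> ?S" "w \<in> ?S" for v w
  proof -
    have "v \<in> P" "w \<in> P" using that by (blast intro: subsetD[OF S(1)])+
    moreover have "le v w \<or> le w v" using S(2) that by blast
    ultimately show ?thesis by (elim disjE) (simp_all add: const[of v w] const[of w v])
  qed
  show False
  proof (cases "\<exists>v\<in>?S. f v = f a")
    case True
    then obtain v where v: "v \<in> ?S" "f v = f a" by blast
    have "?S \<subseteq> {v. f v = f a}" using same[OF _ v(1)] v(2) by auto
    then have "\<phi> t = sum t ?S"
      unfolding \<phi>_def by (intro sum.mono_neutral_right) auto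
    then show False using sum1 half by simp
  next
    case False
    then have "\<phi> t = 0" unfolding \<phi>_def by (intro sum.neutral) auto
    then show False using half by simp
  qed
qed

text \<open>Downward induction on \<open>X\<close>: larger supports give that \<open>e\<close> fixes
  the edges of the complex, connectedness makes the defect of \<open>e\<close> the same at all
  vertices, and idempotency of \<open>e\<close> then kills it.\<close>

lemma band_unit_fixes_vertex:
  fixes X :: "'b::left_regular_band set" and k :: "'k::{comm_ring, comm_monoid_mult}"
  assumes conn: "connected_lrb TYPE('b)" and "X \<in> support_lattice" and "a \<in> B_ge X"
  shows "chain_act X band_unit (Poly_Mapping.single [a] k) = Poly_Mapping.single [a] k"
  using assms(2,3)
proof (induction "card (- X)" arbitrary: X a k rule: less_induct)
  case less
  let ?e = "band_unit :: ('b, 'k) semigroup_algebra"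
  define D where "D = (\<lambda>k a. Poly_Mapping.single [a] k - chain_act X ?e (Poly_Mapping.single [a] k))"
  have vertex: "Poly_Mapping.single [x] l \<in> chain_group X 0" if "x \<in> B_ge X" for x and l :: 'k
    using that by (intro chain_group_single) (auto simp: ordered_simplices_iff)
  have idem: "chain_act X ?e (chain_act X ?e c) = chain_act X ?e c" if "c \<in> chain_group X q" for c q
    using chain_act_mult[OF that, of ?e ?e] by (simp add: mult_band_unit)
  \<comment> \<open>The top vertex \<open>y\<close> of an edge has support strictly above
    \<open>X\<close>, so the induction hypothesis applies to \<open>sigma y\<close>.\<close>
  have edge: "chain_act X ?e (Poly_Mapping.single zs l) = Poly_Mapping.single zs l"
    if "zs \<in> ordered_simplices X" "length zs = 1 + 1" for zs l
  proof (rule band_unit_fixes_simplex[OF _ that])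
    fix ys assume ys: "ys \<in> ordered_simplices X" "length ys = 1 + 1"
    then obtain x y where [simp]: "ys = [x, y]"
      by (auto simp: length_Suc_conv numeral_2_eq_2)
    have "X \<subset> sigma y"
      using ys(1) R_less_imp_sigma_less[of x y] by (auto simp: ordered_simplices_iff B_ge_def)
    then have "card (- sigma y) < card (- X)"
      by (intro psubset_card_mono) auto
    then show "chain_act (sigma (last ys)) band_unit (Poly_Mapping.single [last ys] 1) =
        Poly_Mapping.single [last ys] (1 :: 'k)"
      using less.hyps[of "sigma y" y] by (simp add: B_ge_def)
  qed
  \<comment> \<open>The edge from \<open>x\<close> to \<open>y\<close> is fixed by \<open>e\<close>,
    hence so is its boundary, the difference of the two vertices.\<close>
  have D_less: "D l x = D l y" if "x \<in> B_ge X" "y \<in> B_ge X" "R_le x y" for l x y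
  proof (cases "x = y")
    case False
    then have xy: "[x, y] \<in> ordered_simplices X"
      using that by (simp add: ordered_simplices_iff R_less_def)
    let ?c = "Poly_Mapping.single [x, y] l"
    have c: "?c \<in> chain_group X (Suc 0)"
      using xy by (intro chain_group_single) auto
    have b: "boundary ?c = Poly_Mapping.single [y] l - Poly_Mapping.single [x] l"
      by (simp add: boundary_single face_sum_def single_uminus)
    have "boundary ?c = chain_act X ?e (boundary ?c)"
      using boundary_chain_act[OF c, of ?e] edge[OF xy] by simp
    then show ?thesis
      unfolding b chain_act_diff_right D_def by (simp add: algebra_simps)
  qed simp
  have D_const: "D l x = D l y" if "x \<in> B_ge X" "y \<in> B_ge X" for l x y
  proof (rule connected_order_complex_constant[where P = "B_ge X" and le = R_le])
    show "connected (geometric_realization (order_complex R_le (B_ge X)))"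
      using conn less.prems by (simp add: connected_lrb_def)
  qed (use that D_less R_le_refl in auto)
  have D_add: "D (l + m) x = D l x + D m x" for l m x
    by (simp add: D_def single_add chain_act_add_right)
  have D_zero: "D 0 x = 0" for x by (simp add: D_def)
  have defect: "c - chain_act X ?e c = D (augmentation c) a" if "c \<in> chain_group X 0" for c
    using that
  proof (induction c rule: chain_group_induct)
    case (single zs l)
    then obtain z where "zs = [z]" by (auto simp: length_Suc_conv)
    then show ?case
      using single D_const[of z a l] less.prems by (simp add: ordered_simplices_iff D_def)
  next
    case (add c d)
    then show ?case by (simp add: chain_act_add_right augmentation_add D_add algebra_simps)
  qed (simp add: D_zero)
  have Da: "D k a \<in> chain_group X 0"
    unfolding D_def by (intro chain_group_diff chain_act_closed vertex less.prems)
  \<comment> \<open>\<open>D k a\<close> is itself a vertex chain of augmentation 0, so its own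
    defect vanishes and \<open>e\<close> fixes it; but \<open>e\<close> kills every defect, being
    idempotent on chains.\<close>
  have "augmentation (D k a) = 0"
    by (simp add: D_def augmentation_diff augmentation_chain_act[OF vertex] less.prems simple_act_band_unit)
  then have "D k a = chain_act X ?e (D k a)"
    using defect[OF Da] by (simp add: D_zero)
  also have "\<dots> = 0"
    unfolding D_def chain_act_diff_right using idem[OF vertex[OF less.prems(2)]] by simp
  finally show ?case by (simp add: D_def)
qed

lemma band_unit_fixes_chain:
  fixes X :: "'b::left_regular_band set"
  assumes "connected_lrb TYPE('b)" and "c \<in> chain_group X q"
  shows "chain_act X band_unit c = c"
  using assms(2)
proof (induction c rule: chain_group_induct)
  case (single zs k)
  show ?case
    by (rule band_unit_fixes_simplex[OF _ single])
      (intro band_unit_fixes_vertex[OF assms(1)], auto simp: B_ge_def)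
qed (simp_all add: chain_act_add_right)

text \<open>For the least support the vertices of the complex are all of the band, and the action on
  them is left multiplication. That \<open>e\<close> fixes the vertex \<open>[a]\<close> therefore
  reads \<open>e a = a\<close> in the algebra.\<close>

lemma band_unit_mult:
  fixes r :: "('b::left_regular_band, 'k::{comm_ring, comm_monoid_mult}) semigroup_algebra"
  assumes "connected_lrb TYPE('b)"
  shows "band_unit * r = r"
proof (induction r rule: monomial_induct)
  case (monomial a k)
  let ?e = "band_unit :: ('b, 'k) semigroup_algebra"
  obtain z :: 'b where z: "\<And>y :: 'b. card (sigma z) \<le> card (sigma y)"
    using ex_has_least_nat[of "\<lambda>_. True" undefined "\<lambda>y::'b. card (sigma y)"] by auto
  \<comment> \<open>A support of minimal cardinality is least, since intersecting it with another
    support cannot shrink it.\<close>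
  have min: "sigma z \<subseteq> sigma y" for y :: 'b
  proof -
    have "sigma (y * z) = sigma z"
      using z[of "y * z"] by (intro card_seteq) (auto simp: sigma_mult)
    then show ?thesis by (auto simp: sigma_mult)
  qed
  have act: "chain_monomial_act (sigma z) b m [a] = Poly_Mapping.single [b * a] m" for b and m :: 'k
    using min by (simp add: chain_monomial_act_def ordered_simplices_iff B_ge_def)
  have "a \<in> B_ge (sigma z)" using min by (simp add: B_ge_def)
  from band_unit_fixes_vertex[OF assms sigma_in_support_lattice this, of k]
  have *: "(\<Sum>b\<in>UNIV. Poly_Mapping.single [b * a] (coeff ?e b * k)) = Poly_Mapping.single [a] k"
    unfolding chain_act_single act .
  show ?case
  proof (rule semigroup_algebra_eqI)
    fix c
    have "coeff (?e * monomial a k) c = (\<Sum>b\<in>UNIV. if b * a = c then coeff ?e b * k else 0)"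
    proof -
      have "(\<Sum>x\<in>UNIV. if b * x = c then coeff ?e b * coeff (monomial a k) x else 0) =
          (\<Sum>x\<in>UNIV. if x = a then (if b * a = c then coeff ?e b * k else 0) else 0)" for b
        by (intro sum.cong refl) auto
      then show ?thesis
        unfolding times_semigroup_algebra.rep_eq by simp
    qed
    also have "\<dots> = Poly_Mapping.lookup (\<Sum>b\<in>UNIV. Poly_Mapping.single [b * a] (coeff ?e b * k)) [c]"
      by (simp add: lookup_sum lookup_single when_def)
    also have "\<dots> = coeff (monomial a k) c"
      unfolding * by (auto simp: lookup_single)
    finally show "coeff (?e * monomial a k) c = coeff (monomial a k) c" .
  qed
qed (simp_all add: distrib_left)

lemma ring_identity_band_unit:
  "connected_lrb TYPE('b) \<Longrightarrow> ring_identity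
    (band_unit :: ('b::left_regular_band, 'k::{comm_ring, comm_monoid_mult}) semigroup_algebra)"
  by (simp add: ring_identity_def mult_band_unit band_unit_mult)


section \<open>Projectivity and exactness\<close>

lemma left_module_sum:
  assumes "left_module M act" and "\<And>i. i \<in> I \<Longrightarrow> f i \<in> M"
  shows "sum f I \<in> M"
  using assms(2)
  by (induction I rule: infinite_finite_induct)
    (auto intro: left_module.zero_closed[OF assms(1)] left_module.add_closed[OF assms(1)])

lemma additive_on_sum:
  fixes f :: "'m::ab_group_add \<Rightarrow> 'n::ab_group_add"
  assumes M: "left_module M act" and add: "\<And>x y. x \<in> M \<Longrightarrow> y \<in> M \<Longrightarrow> f (x + y) = f x + f y"
    and "\<And>i. i \<in> I \<Longrightarrow> h i \<in> M"
  shows "f (sum h I) = (\<Sum>i\<in>I. f (h i))"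
proof -
  have f0: "f 0 = 0"
    using add[of 0 0] left_module.zero_closed[OF M] by simp
  show ?thesis
    using assms(3)
    by (induction I rule: infinite_finite_induct) (auto simp: f0 add left_module_sum[OF M])
qed

lemma left_module_act_zero:
  assumes "left_module M act" and "x \<in> M" shows "act 0 x = 0"
  using left_module.act_add_left[OF assms, of 0 0] by simp

lemma left_module_simple:
  fixes X :: "'b::left_regular_band set"
  assumes "connected_lrb TYPE('b)" and "X \<in> support_lattice"
  shows "left_module (UNIV :: 'k::{comm_ring, comm_monoid_mult} set) (simple_act X)"
proof
  show "\<exists>e. ring_identity e \<and> (\<forall>x\<in>UNIV. simple_act X e x = (x :: 'k))"
    using ring_identity_band_unit[OF assms(1)] simple_act_band_unit[OF assms(2)] by blast
qed (simp_all add: simple_act_add_left simple_act_add_right simple_act_mult)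

lemma left_module_chain_group:
  fixes X :: "'b::left_regular_band set"
  assumes "connected_lrb TYPE('b)"
  shows "left_module (chain_group X q :: ('b list \<Rightarrow>\<^sub>0 'k::{comm_ring, comm_monoid_mult}) set) (chain_act X)"
proof
  show "\<exists>e. ring_identity e \<and> (\<forall>c\<in>chain_group X q. chain_act X e c = (c :: 'b list \<Rightarrow>\<^sub>0 'k))"
    using ring_identity_band_unit[OF assms] band_unit_fixes_chain[OF assms] by blast
qed (auto simp: chain_act_add_left chain_act_add_right chain_act_mult
    intro: chain_group_add chain_group_uminus chain_act_closed)

text \<open>
  Writing \<open>f\<^sub>W = support_rep W\<close> and \<open>e\<^sub>W = support_idem W\<close>, a lift of \<open>f\<close> along \<open>g\<close> sends a simplex
  \<open>zs\<close> with last vertex \<open>z\<close> to \<open>\<Sum>\<^sub>W z e\<^sub>W \<cdot> s (f (f\<^sub>W \<cdot> zs))\<close> for any section \<open>s\<close> of \<open>g\<close> with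
  \<open>s 0 = 0\<close>. It is equivariant although \<open>s\<close> is not, because \<open>z e\<^sub>W = 0\<close> unless \<open>W \<subseteq> sigma z\<close>, and
  \<open>f\<^sub>W b = f\<^sub>W\<close> when \<open>W \<subseteq> sigma b\<close>. It is a lift because \<open>e\<^sub>W f\<^sub>W = e\<^sub>W\<close>, the \<open>e\<^sub>W\<close> sum to the identity
  and \<open>z \<cdot> zs = zs\<close>.
\<close>

lemma projective_chain_group:
  fixes X :: "'b::left_regular_band set"
  assumes conn: "connected_lrb TYPE('b)"
  shows "projective_module TYPE('m::ab_group_add) TYPE('n::ab_group_add)
    (chain_group X q :: ('b list \<Rightarrow>\<^sub>0 'k::{comm_ring, comm_monoid_mult}) set) (chain_act X)"
  unfolding projective_module_def
proof (intro conjI left_module_chain_group[OF conn] allI impI, elim conjE)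
  let ?C = "chain_group X q :: ('b list \<Rightarrow>\<^sub>0 'k) set"
  fix M :: "'m set" and actM :: "('b, 'k) semigroup_algebra \<Rightarrow> 'm \<Rightarrow> 'm"
    and N :: "'n set" and actN g f
  assume M: "left_module M actM" and N: "left_module N actN"
    and g: "g \<in> module_homs M actM N actN" and surj: "g ` M = N"
    and f: "f \<in> module_homs ?C (chain_act X) N actN"
  note C = left_module_chain_group[OF conn, where X = X and q = q and 'k = 'k]
  interpret M: left_module M actM by (fact M)
  interpret N: left_module N actN by (fact N)
  have f_closed: "f c \<in> N" if "c \<in> ?C" for c using f that by (auto simp: module_homs_def)
  have f_add: "f (c + d) = f c + f d" if "c \<in> ?C" "d \<in> ?C" for c d
    using f that by (auto simp: module_homs_def)
  have f_act: "f (chain_act X r c) = actN r (f c)" if "c \<in> ?C" for r c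
    using f that by (auto simp: module_homs_def)
  have f_zero: "f 0 = 0" using f_add[of 0 0] by simp
  have g_add: "g (x + y) = g x + g y" if "x \<in> M" "y \<in> M" for x y
    using g that by (auto simp: module_homs_def)
  have g_act: "g (actM r x) = actN r (g x)" if "x \<in> M" for r x
    using g that by (auto simp: module_homs_def)
  have g_zero: "g 0 = 0" using g_add[of 0 0] M.zero_closed by simp
  have actM_zero: "actM r 0 = 0" for r
    using M.act_add_right[OF M.zero_closed M.zero_closed, of r] by simp

  \<comment> \<open>The default 0 outside \<open>N\<close> keeps every value of \<open>s\<close> in
    \<open>M\<close>.\<close>
  define s where "s = (\<lambda>n. if n \<in> N \<and> n \<noteq> 0 then SOME m. m \<in> M \<and> g m = n else 0)"
  have some: "(SOME m. m \<in> M \<and> g m = n) \<in> M \<and> g (SOME m. m \<in> M \<and> g m = n) = n" if "n \<in> N" for n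
    using surj that by - (rule someI_ex, auto)
  have s_closed: "s n \<in> M" for n using some M.zero_closed by (simp add: s_def)
  have g_s: "g (s n) = n" if "n \<in> N" for n using that some g_zero by (simp add: s_def)
  have s_zero: "s 0 = 0" by (simp add: s_def)

  define rep where "rep = (\<lambda>W zs. chain_act X (monomial (support_rep W) 1) (Poly_Mapping.single zs (1 :: 'k)))"
  \<comment> \<open>The argument of \<open>s\<close> is formed with coefficient 1 and
    \<open>k\<close> enters through the acting element, so \<open>lift\<close> is additive in
    \<open>k\<close> although \<open>s\<close> need not be additive.\<close>
  define lift where "lift = (\<lambda>zs k. \<Sum>W\<in>support_lattice.
    actM (monomial (last zs) k * support_idem W) (s (f (rep W zs))))"
  define h where "h = pm_extend lift"
  have lift_closed: "lift zs k \<in> M" for zs k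
    unfolding lift_def by (intro left_module_sum[OF M] M.act_closed s_closed)
  have lift_zero: "lift zs 0 = 0" for zs
    by (simp add: lift_def left_module_act_zero[OF M] s_closed)
  have lift_add: "lift zs (k + l) = lift zs k + lift zs l" for zs k l
    by (simp add: lift_def monomial_add distrib_right M.act_add_left s_closed sum.distrib)
  have h_zero: "h 0 = 0" and h_add: "h (c + d) = h c + h d"
    and h_single: "h (Poly_Mapping.single zs k) = lift zs k" for c d zs k
    by (simp_all add: h_def pm_extend_add pm_extend_single lift_zero lift_add)
  have h_closed: "h c \<in> M" for c
    unfolding h_def pm_extend_def by (intro left_module_sum[OF M] lift_closed)

  have single_closed: "Poly_Mapping.single zs k \<in> ?C"
    if "zs \<in> ordered_simplices X" "length zs = q + 1" for zs k
    using that by (rule chain_group_single)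

  have h_act: "h (chain_act X r c) = actM r (h c)" if "c \<in> ?C" for r c
    using that
  proof (induction c rule: chain_group_induct)
    case (single zs l)
    have ne: "zs \<noteq> []" using single by auto
    show ?case
    proof (induction r rule: monomial_induct)
      case zero
      then show ?case by (simp add: h_zero left_module_act_zero[OF M h_closed])
    next
      case (add r1 r2)
      then show ?case by (simp add: chain_act_add_left h_add M.act_add_left[OF h_closed])
    next
      case (monomial b k)
      let ?z = "last zs"
      have R: "actM (monomial b k) (h (Poly_Mapping.single zs l)) = (\<Sum>W\<in>support_lattice.
          actM (monomial (b * ?z) (k * l) * support_idem W) (s (f (rep W zs))))"
        unfolding h_single lift_def
        by (subst additive_on_sum[OF M M.act_add_right])
          (auto simp: M.act_closed s_closed monomial_mult simp flip: M.act_mult mult.assoc)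
      have vanish: "monomial (b * ?z) m * support_idem W = 0"
        if "W \<in> support_lattice" "\<not> W \<subseteq> sigma b" for W and m :: 'k
        using that by (intro mult_support_idem_eq_0) (auto simp: sigma_mult)
      have rep: "rep W zs =
          chain_act X (monomial (support_rep W) 1) (chain_monomial_act X b 1 zs)"
        if "W \<in> support_lattice" "W \<subseteq> sigma b" for W
      proof -
        have "support_rep W * b = support_rep W"
          using that by (simp add: sigma_support_rep flip: sigma_le_iff)
        then show ?thesis
          using chain_act_mult[OF single_closed[OF single], of "monomial (support_rep W) 1" "monomial b 1" 1]
          by (simp add: rep_def monomial_mult chain_act_monomial_single)
      qed
      show ?case
      proof (cases "X \<subseteq> sigma b \<and> map ((*) b) zs \<in> ordered_simplices X")
        case True
        have "actM (monomial (b * ?z) (k * l) * support_idem W) (s (f (rep W (map ((*) b) zs)))) =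
            actM (monomial (b * ?z) (k * l) * support_idem W) (s (f (rep W zs)))"
          if "W \<in> support_lattice" for W
        proof (cases "W \<subseteq> sigma b")
          case W: True
          then show ?thesis
            using True by (simp add: rep[OF that W]) (simp add: rep_def chain_monomial_act_def)
        next
          case False
          then show ?thesis
            by (simp add: vanish that left_module_act_zero[OF M] s_closed)
        qed
        then show ?thesis
          unfolding R using True ne
          by (simp add: chain_act_monomial_single chain_monomial_act_def h_single lift_def last_map)
      next
        case False
        \<comment> \<open>When \<open>b\<close> kills \<open>zs\<close>, every term must vanish: for
          \<open>W \<subseteq> sigma b\<close> the element \<open>rep W zs\<close> factors through
          the zero chain and \<open>s 0 = 0\<close>, and for other \<open>W\<close> the acting
          element is 0.\<close>
        then have zero: "chain_monomial_act X b m zs = 0" for m :: 'k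
          by (auto simp: chain_monomial_act_def)
        have "actM (monomial (b * ?z) (k * l) * support_idem W) (s (f (rep W zs))) = 0"
          if "W \<in> support_lattice" for W
        proof (cases "W \<subseteq> sigma b")
          case True
          then show ?thesis by (simp add: rep[OF that True] zero f_zero s_zero actM_zero)
        next
          case False
          then show ?thesis
            by (simp add: vanish that left_module_act_zero[OF M] s_closed)
        qed
        then show ?thesis
          unfolding R by (simp add: chain_act_monomial_single zero h_zero)
      qed
    qed
  next
    case (add c d)
    then show ?case by (simp add: chain_act_add_right h_add M.act_add_right h_closed)
  qed (simp add: h_zero actM_zero)

  have g_h: "g (h c) = f c" if "c \<in> ?C" for c
    using that
  proof (induction c rule: chain_group_induct)
    case (single zs k)
    let ?z = "last zs" and ?c = "Poly_Mapping.single zs (1 :: 'k)"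
    note c = single_closed[OF single, of 1]
    have rep_closed: "rep W zs \<in> ?C" for W
      unfolding rep_def by (intro chain_act_closed c)
    have "g (h (Poly_Mapping.single zs k)) =
        (\<Sum>W\<in>support_lattice. actN (monomial ?z k * support_idem W) (f (rep W zs)))"
      unfolding h_single lift_def
      by (subst additive_on_sum[OF M g_add])
        (auto simp: M.act_closed s_closed g_act g_s f_closed rep_closed)
    also have "\<dots> = (\<Sum>W\<in>support_lattice. f (chain_act X (monomial ?z k * support_idem W) ?c))"
    proof (intro sum.cong refl)
      fix W :: "'b set"
      have "chain_act X (monomial ?z k * support_idem W) (rep W zs) =
          chain_act X (monomial ?z k * (support_idem W * monomial (support_rep W) 1)) ?c"
        unfolding rep_def by (simp add: mult.assoc flip: chain_act_mult[OF c])
      then show "actN (monomial ?z k * support_idem W) (f (rep W zs)) =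
          f (chain_act X (monomial ?z k * support_idem W) ?c)"
        by (simp add: support_idem_rep flip: f_act[OF rep_closed])
    qed
    also have "\<dots> = f (chain_act X (monomial ?z k * band_unit) ?c)"
      unfolding band_unit_def sum_distrib_left chain_act_sum_left
      by (rule additive_on_sum[OF C f_add, symmetric]) (auto intro: chain_act_closed c)
    also have "chain_act X (monomial ?z k * band_unit) ?c = Poly_Mapping.single zs k"
    proof -
      have "?z \<in> set zs" using single by (intro last_in_set) auto
      then have "X \<subseteq> sigma ?z"
        using single(1) unfolding ordered_simplices_iff B_ge_def by blast
      then show ?thesis
        using single(1) by (simp add: mult_band_unit chain_act_monomial_single chain_monomial_act_def
            map_last_mult)
    qed
    finally show ?case .
  qed (simp_all add: h_zero g_zero f_zero h_add g_add h_closed f_add)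

  show "\<exists>h\<in>module_homs ?C (chain_act X) M actM. \<forall>c\<in>?C. g (h c) = f c"
    using h_closed h_add h_act g_h by (intro bexI[of _ h]) (auto simp: module_homs_def)
qed

text \<open>
  Each \<open>b\<close> maps the complex into the cone with apex \<open>b\<close>, so it annihilates the reduced homology;
  hence so does the identity element of the algebra.
\<close>

lemma chain_exact:
  fixes X :: "'b::left_regular_band set" and c :: "'b list \<Rightarrow>\<^sub>0 'k::{comm_ring, comm_monoid_mult}"
  assumes conn: "connected_lrb TYPE('b)" and c: "c \<in> chain_group X q"
    and cycle: "\<And>r. boundary (chain_act X r c) = 0"
  shows "c \<in> boundary ` chain_group X (Suc q)"
proof -
  let ?e = "band_unit :: ('b, 'k) semigroup_algebra"
  let ?c = "\<lambda>b. chain_act X (monomial b (coeff ?e b)) c"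
  have "\<exists>d\<in>chain_group X (Suc q). boundary d = ?c b" for b
  proof (cases "X \<subseteq> sigma b")
    case True
    then show ?thesis
      by (intro cone_exact[where b = b] keys_chain_act_monomial[OF c] cycle)
  next
    case False
    then have "?c b = 0"
      unfolding chain_act_monomial pm_extend_def by (simp add: chain_monomial_act_def)
    then show ?thesis by (intro bexI[of _ 0]) simp_all
  qed
  then obtain d where d: "\<And>b. d b \<in> chain_group X (Suc q)" "\<And>b. boundary (d b) = ?c b"
    by metis
  have "c = (\<Sum>b\<in>UNIV. ?c b)"
    using band_unit_fixes_chain[OF conn c] by (simp flip: chain_act_monomials)
  also have "\<dots> = boundary (\<Sum>b\<in>UNIV. d b)"
    by (simp add: boundary_sum d)
  finally show ?thesis
    by (rule image_eqI) (intro chain_group_sum d)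
qed

theorem theorem18:
  fixes X :: "'b::left_regular_band set"
  assumes "connected_lrb TYPE('b)"
    and "X \<in> support_lattice"
  shows "projective_resolution TYPE('m::ab_group_add) TYPE('n::ab_group_add)
    (chain_group X :: nat \<Rightarrow> ('b list \<Rightarrow>\<^sub>0 'k::{comm_ring, comm_monoid_mult}) set)
    (\<lambda>_. chain_act X) (\<lambda>_. boundary) augmentation (UNIV :: 'k set) (simple_act X)"
  unfolding projective_resolution_def
proof (intro conjI allI left_module_simple[OF assms] projective_chain_group[OF assms(1)])
  let ?C = "chain_group X :: nat \<Rightarrow> ('b list \<Rightarrow>\<^sub>0 'k) set"
  show "boundary \<in> module_homs (?C (Suc q)) (chain_act X) (?C q) (chain_act X)" for q
    by (auto simp: module_homs_def boundary_add boundary_chain_act boundary_closed)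
  show "augmentation \<in> module_homs (?C 0) (chain_act X) UNIV (simple_act X)"
    by (auto simp: module_homs_def augmentation_add augmentation_chain_act)
  show "augmentation ` ?C 0 = UNIV"
  proof -
    \<comment> \<open>A representative of \<open>X\<close> is a vertex of the complex, and its
      multiples already realize every value of the augmentation.\<close>
    obtain a where "X = sigma a" using assms(2) by (auto simp: support_lattice_def)
    then have "Poly_Mapping.single [a] k \<in> ?C 0" for k
      by (intro chain_group_single) (auto simp: ordered_simplices_iff B_ge_def)
    then show ?thesis
      by (metis UNIV_eq_I augmentation_single imageI)
  qed
  show "{c \<in> ?C 0. augmentation c = 0} = boundary ` ?C 1"
  proof (intro equalityI subsetI)
    fix c assume c: "c \<in> {c \<in> ?C 0. augmentation c = 0}"
    \<comment> \<open>The chains of augmentation 0 form a submodule, and in degree 0 they are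
      exactly the chains with zero boundary, which supplies the cycle condition for all
      \<open>r\<close>.\<close>
    then have "c \<in> boundary ` ?C (Suc 0)"
      by (intro chain_exact[OF assms(1)])
        (auto simp: boundary_vertices[OF chain_act_closed] augmentation_chain_act)
    then show "c \<in> boundary ` ?C 1" by simp
  qed (auto simp: augmentation_boundary intro: boundary_closed)
  show "{c \<in> ?C (Suc q). boundary c = 0} = boundary ` ?C (Suc (Suc q))" for q
    by (auto simp: boundary_boundary boundary_closed boundary_chain_act
        intro!: chain_exact[OF assms(1)])
qed

end
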